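(* Let $a<b$ be real numbers, $Q$ a probability measure on $[a,b]$, $K$ a positive integer and $f$ a continuous, monotone, convex-concave function on $[a,b]$ with variation $V=|f(b)-f(a)|$ and linear index $\Gamma\in[0,1]$. Set $\underline\delta=|f'_r(a)|\wedge|f'_l(b)|$ and $\overline\delta=|f'_r(a)|\vee|f'_l(b)|\in[0,+\infty]$. (i) If $|f'_r(a)-f'_l(b)|$ is finite, there exists a $K$-linear interpolation $\overline f$ of $f$ on $[a,b]$ such that $$\int_{[a,b]}|f-\overline f|\,dQ\le\frac{|f'_r(a)-f'_l(b)|(b-a)}{4K^2}.$$ (ii) If $Q$ has a modulus $w$ that satisfies for all $x>0$ $$\Psi(x)=\int_0^x\frac{\overline w(t)}{t}\,dt<+\infty\quad\text{with }\overline w(\cdot)=w(\cdot)-w(0),$$ then for every $\delta\in[\underline\delta,\overline\delta]\cap(0,+\infty)$ there exists a $(2K)$-linear interpolation $\overline f$ of $f$ on $[a,b]$ such that $$\int_{[a,b]}|f-\overline f|\,dQ\le Vw(0)+\frac{(\delta-\underline\delta)(b-a)}{4K^2}+\frac VK\left[\Psi\left(\frac{V}{2K\delta}\right)-\Psi\left(\frac{V}{2K\overline\delta}\right)\right].$$ In particular, if $Q$ has a modulus of the form $w(u)=w(0)+A u^\alpha/(b-a)^\alpha$ with $A\ge1$ and $\alpha\in(0,1]$, there exists a $(2K)$-linear interpolation $\overline f$ of $f$ on $[a,b]$ such that $$\int_{[a,b]}|f-\overline f|\,dQ\le V\left[w(0)+\left(\frac{2^{1-\alpha}A}{\alpha K^{1+3\alpha}}\right)^{\frac1{1+\alpha}}\right].$$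 Furthermore, if $\alpha=1=A$ then $\overline f$ satisfies $$\int_{[a,b]}|f-\overline f|\,dQ\le V\left[w(0)+\frac{\Gamma}{K^2}\right].$$
   Context: A function on $[a,b]$ is convex-concave if it is either convex or concave on $[a,b]$. For such a continuous $f$, $f'_r(x)$ and $f'_l(x)$ are its right and left derivatives at $x$, allowed to take the values $\pm\infty$. Linear index: for $f$ continuous, monotone and convex-concave on $[a,b]$, $$\Gamma=\Gamma(f)=1-\frac12\left[\frac{|f'_r(a)|\wedge|f'_l(b)|}{|\Delta|}+\frac{|\Delta|}{|f'_r(a)|\vee|f'_l(b)|}\right],\quad\Delta=\frac{f(b)-f(a)}{b-a},$$ with the conventions $0/0=1$ and $1/(+\infty)=0$; it belongs to $[0,1]$. (In (ii), when $\overline\delta=+\infty$, $V/(2K\overline\delta)=0$ and $\Psi(0)=0$.) $K$-linear interpolation: $l$ is a $K$-linear interpolation of $f$ on $[a,b]$ if there is a subdivision $a_0=a<a_1<\ldots<a_K=b$ such that, for all $i\in\{1,\ldots,K\}$, $l$ is affine on $[a_{i-1},a_i]$ and $l(a_{i-1})=f(a_{i-1})$, $l(a_i)=f(a_i)$. Modulus: with $\lambda$ the Lebesgue measure on $\mathbb R$, a modulus $w$ of a Borel measure $\mu$ on $\mathbb R$ is a nonnegative, nondecreasing, concave function on $[0,+\infty)$ such that $\mu(I)\le w(\lambda(I))$ for every bounded interval $I\subset\mathbb R$ ($w(0)=0$ is not required). $Q$ is viewed as a Borel measure on $\mathbb R$ carried by $[a,b]$. $x\wedge y$ and $x\vee y$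 are the minimum and maximum. *)

theory Defs
  imports "HOL-Probability.Probability"
begin

definition convex_concave_on :: "real set \<Rightarrow> (real \<Rightarrow> real) \<Rightarrow> bool" where
  "convex_concave_on S f \<longleftrightarrow> convex_on S f \<or> concave_on S f"

text \<open>One-sided derivatives with values in the extended reals. The limits exist when \<open>f\<close> is
  convex or concave on an interval on the relevant side of \<open>x\<close>.\<close>

definition right_derivative :: "(real \<Rightarrow> real) \<Rightarrow> real \<Rightarrow> ereal" where
  "right_derivative f x = Lim (at_right x) (\<lambda>y. ereal ((f y - f x) / (y - x)))"

definition left_derivative :: "(real \<Rightarrow> real) \<Rightarrow> real \<Rightarrow> ereal" where
  "left_derivative f x = Lim (at_left x) (\<lambda>y. ereal ((f y - f x) / (y - x)))"

definition min_end_slope :: "(real \<Rightarrow> real) \<Rightarrow> real \<Rightarrow> real \<Rightarrow> ereal" where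
  "min_end_slope f a b = min \<bar>right_derivative f a\<bar> \<bar>left_derivative f b\<bar>"

definition max_end_slope :: "(real \<Rightarrow> real) \<Rightarrow> real \<Rightarrow> real \<Rightarrow> ereal" where
  "max_end_slope f a b = max \<bar>right_derivative f a\<bar> \<bar>left_derivative f b\<bar>"

text \<open>The quotient of extended reals with the convention that 0/0 is 1 (the library has 0).
  Finite numbers divided by infinity already give 0.\<close>

definition quotient1 :: "ereal \<Rightarrow> ereal \<Rightarrow> ereal" where
  "quotient1 x y = (if x = 0 \<and> y = 0 then 1 else x / y)"

definition linear_index :: "(real \<Rightarrow> real) \<Rightarrow> real \<Rightarrow> real \<Rightarrow> ereal" where
  "linear_index f a b =
     (let \<Delta> = \<bar>(f b - f a) / (b - a)\<bar> in
      1 - ereal (1 / 2) *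
        (quotient1 (min_end_slope f a b) (ereal \<Delta>) + quotient1 (ereal \<Delta>) (max_end_slope f a b)))"

definition affine_fun_on :: "real set \<Rightarrow> (real \<Rightarrow> real) \<Rightarrow> bool" where
  "affine_fun_on S l \<longleftrightarrow> (\<exists>c d. \<forall>x\<in>S. l x = c * x + d)"

definition linear_interpolation ::
    "nat \<Rightarrow> (real \<Rightarrow> real) \<Rightarrow> real \<Rightarrow> real \<Rightarrow> (real \<Rightarrow> real) \<Rightarrow> bool" where
  "linear_interpolation K f a b l \<longleftrightarrow>
     (\<exists>s :: nat \<Rightarrow> real. s 0 = a \<and> s K = b \<and>
        (\<forall>i\<in>{1..K}. s (i - 1) < s i \<and> affine_fun_on {s (i - 1)..s i} l \<and>
           l (s (i - 1)) = f (s (i - 1)) \<and> l (s i) = f (s i)))"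

text \<open>Only the values of \<open>w\<close> on \<open>{0..}\<close> matter.\<close>

definition is_modulus :: "real measure \<Rightarrow> (real \<Rightarrow> real) \<Rightarrow> bool" where
  "is_modulus \<mu> w \<longleftrightarrow>
     (\<forall>u\<ge>0. 0 \<le> w u) \<and> mono_on {0..} w \<and> concave_on {0..} w \<and>
     (\<forall>I. is_interval I \<and> bounded I \<longrightarrow> emeasure \<mu> I \<le> ennreal (w (measure lborel I)))"

text \<open>For a modulus \<open>w\<close> the integrand below is nonnegative, so finiteness of the
  integral is integrability.\<close>

definition modulus_integrand :: "(real \<Rightarrow> real) \<Rightarrow> real \<Rightarrow> real" where
  "modulus_integrand w t = (w t - w 0) / t"

definition Psi :: "(real \<Rightarrow> real) \<Rightarrow> real \<Rightarrow> real" where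
  "Psi w x = (LBINT t:{0<..x}. modulus_integrand w t)"

definition Psi_finite :: "(real \<Rightarrow> real) \<Rightarrow> bool" where
  "Psi_finite w \<longleftrightarrow> (\<forall>x>0. set_integrable lborel {0<..x} (modulus_integrand w))"

end

theory Submission
  imports Defs
begin

text \<open>Up to a change of sign and a reflection of \<open>[a, b]\<close>, \<open>f\<close> is concave and nondecreasing. For (i) the
  subdivision is chosen such that, on every piece, the increment of the slope relative to its total
  increment and the length relative to \<open>b - a\<close> sum up to at most \<open>2 / K\<close>; by the arithmetic-geometric mean
  inequality their product is then at most \<open>1 / K\<^sup>2\<close>. For (ii) the interval is split at a point where
  the slope is \<open>\<delta>\<close>. On the flat side (i) applies. The steep side is cut into pieces of equal
  variation; on a piece of length \<open>L\<close> the error is below a linear function vanishing at the flat end, whose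
  \<open>Q\<close>-integral is controlled by \<open>w (L / 2)\<close>, and these bounds are dominated by increments of \<open>\<Psi>\<close> that
  telescope. The last part follows by optimising \<open>\<delta>\<close>.\<close>

section \<open>Uniform error for convex functions\<close>

text \<open>The obstacle in (ii) is that the slope at the steep end may be infinite, so no
  supporting line is available there. Each steep piece is compared only with the line through its
  flat end, which leaves an error of at most (c - \<delta>)(t - x), where c is the slope of the
  chord and t the flat end. If the height c L of the piece is at most V / K, then L / 2 \<le> V / (2
  K c); this is where the arguments V / (2 K slope) of \<open>Psi\<close> come from. The chord slope
  c then serves as \<delta> for the next steeper piece. An infinite largest slope never enters the
  arithmetic. It is represented by the real number z = V / (2 K \<delta>max), which is 0 in that
  case, and by the inequality 2 K z s \<le> V for all chord slopes s. In (i), both normalised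
  quantities total 1. Cutting off a piece with sum exactly 2 / K leaves a remainder with sum 2 (K -
  1) / K, hence with product at most (1 - 1 / K)^2, which is exactly what K - 1 further pieces can
  afford.\<close>

lemma convex_on_three_points:
  fixes f :: "real \<Rightarrow> real"
  assumes "convex_on S f" "x \<in> S" "z \<in> S" "x \<le> y" "y \<le> z"
  shows "f y * (z - x) \<le> f x * (z - y) + f z * (y - x)"
proof (cases "x = z")
  case True
  with assms show ?thesis by simp
next
  case False
  with assms have xz: "x < z" by simp
  define t where "t = (y - x) / (z - x)"
  have t: "0 \<le> t" "t \<le> 1" using assms xz by (auto simp: t_def field_simps)
  have tz: "t * (z - x) = y - x" using xz by (simp add: t_def)
  have "f ((1 - t) *\<^sub>R x + t *\<^sub>R z) \<le> (1 - t) * f x + t * f z"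
    using convex_onD[OF assms(1) t] assms(2,3) by blast
  moreover have "(1 - t) *\<^sub>R x + t *\<^sub>R z = y"
    using tz by (simp add: algebra_simps)
  ultimately have "f y * (z - x) \<le> ((1 - t) * f x + t * f z) * (z - x)"
    using xz by (simp add: mult_right_mono)
  also have "\<dots> = f x * ((z - x) - t * (z - x)) + f z * (t * (z - x))"
    by (simp add: algebra_simps)
  finally show ?thesis by (simp add: tz)
qed

lemma convex_on_le_chord:
  fixes f :: "real \<Rightarrow> real"
  assumes "convex_on S f" "a \<in> S" "b \<in> S" "a < b" "x \<in> {a..b}"
  shows "f x \<le> f a + (f b - f a) / (b - a) * (x - a)"
proof -
  have "f x * (b - a) \<le> f a * (b - x) + f b * (x - a)"
    using convex_on_three_points[of S f a b x] assms by simp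
  also have "\<dots> = f a * (b - a) + (f b - f a) * (x - a)"
    by (simp add: algebra_simps)
  also have "\<dots> = (f a + (f b - f a) / (b - a) * (x - a)) * (b - a)"
    using assms by (simp add: distrib_right)
  finally show ?thesis using assms by simp
qed

section \<open>Interpolations: gluing, change of sign, reflection\<close>

lemma linear_interpolation_single:
  assumes "a < b"
  shows "linear_interpolation 1 f a b (\<lambda>x. f a + (f b - f a) / (b - a) * (x - a))"
proof -
  have "affine_fun_on {a..b} (\<lambda>x. f a + (f b - f a) / (b - a) * (x - a))"
    unfolding affine_fun_on_def
    by (rule exI[of _ "(f b - f a) / (b - a)"],
        rule exI[of _ "f a - (f b - f a) / (b - a) * a"]) (simp add: right_diff_distrib)
  then show ?thesis
    unfolding linear_interpolation_def using assms
    by (intro exI[of _ "\<lambda>i. if i = 0 then a else b"]) auto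
qed

lemma affine_fun_on_cong:
  "(\<And>x. x \<in> S \<Longrightarrow> l x = l' x) \<Longrightarrow> affine_fun_on S l \<longleftrightarrow> affine_fun_on S l'"
  by (simp add: affine_fun_on_def)

text \<open>The node lists are concatenated at \<open>c\<close>. Since \<open>n\<close> and
  \<open>m\<close> are positive, \<open>c\<close> is a node of both interpolations, so
  \<open>g\<close> and \<open>h\<close> agree there with \<open>f\<close> and the case distinction
  gives \<open>h\<close> on the whole closed right part.\<close>

lemma linear_interpolation_append:
  assumes g: "linear_interpolation n f a c g" and h: "linear_interpolation m f c b h"
    and ac: "a \<le> c" and m: "m > 0" and n: "n > 0"
  shows "linear_interpolation (n + m) f a b (\<lambda>x. if x \<le> c then g x else h x)"
proof -
  let ?l = "\<lambda>x. if x \<le> c then g x else h x"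
  obtain s where s: "s 0 = a" "s n = c"
    "\<And>i. i \<in> {1..n} \<Longrightarrow> s (i - 1) < s i \<and> affine_fun_on {s (i - 1)..s i} g \<and>
           g (s (i - 1)) = f (s (i - 1)) \<and> g (s i) = f (s i)"
    using g unfolding linear_interpolation_def by blast
  obtain r where r: "r 0 = c" "r m = b"
    "\<And>i. i \<in> {1..m} \<Longrightarrow> r (i - 1) < r i \<and> affine_fun_on {r (i - 1)..r i} h \<and>
           h (r (i - 1)) = f (r (i - 1)) \<and> h (r i) = f (r i)"
    using h unfolding linear_interpolation_def by blast
  have sc: "s i \<le> c" if "i \<le> n" for i
    using that
  proof (induction rule: inc_induct)
    case base
    then show ?case by (simp add: s)
  next
    case (step j)
    then show ?case using s(3)[of "Suc j"] by simp
  qed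
  have rc: "c \<le> r i" if "i \<le> m" for i
    using that
  proof (induction i)
    case 0
    then show ?case by (simp add: r)
  next
    case (Suc j)
    then show ?case using r(3)[of "Suc j"] by simp
  qed
  have gc: "g c = f c" using s(2) s(3)[of n] n by auto
  have hc: "h c = f c" using r(1) r(3)[of 1] m by auto
  have lh: "?l x = h x" if "c \<le> x" for x using that gc hc by (cases "x = c") auto
  define q where "q = (\<lambda>i. if i \<le> n then s i else r (i - n))"
  have "q (i - 1) < q i \<and> affine_fun_on {q (i - 1)..q i} ?l \<and>
         ?l (q (i - 1)) = f (q (i - 1)) \<and> ?l (q i) = f (q i)" if i: "i \<in> {1..n + m}" for i
  proof (cases "i \<le> n")
    case True
    then have q: "q i = s i" "q (i - 1) = s (i - 1)" by (auto simp: q_def)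
    have c: "s i \<le> c" "s (i - 1) \<le> c" using sc[of i] sc[of "i - 1"] True by auto
    have lg: "?l x = g x" if "x \<le> c" for x using that by simp
    have "affine_fun_on {s (i - 1)..s i} ?l \<longleftrightarrow> affine_fun_on {s (i - 1)..s i} g"
      by (rule affine_fun_on_cong, rule lg) (use c in auto)
    moreover have "i \<in> {1..n}" using True i by simp
    ultimately show ?thesis using s(3)[of i] unfolding q lg[OF c(1)] lg[OF c(2)] by blast
  next
    case False
    define j where "j = i - n"
    have k: "j \<in> {1..m}" "i = n + j" using False i by (auto simp: j_def)
    have q: "q i = r j" using k by (auto simp: q_def)
    \<comment> \<open>The first piece on the right starts at index \<open>n\<close>, which
      \<open>q\<close> still reads from \<open>s\<close>; the two lists agree there because
      \<open>s n = c = r 0\<close>.\<close>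
    have q': "q (i - 1) = r (j - 1)"
    proof (cases "j = 1")
      case True
      then show ?thesis using s(2) r(1) k(2) by (simp add: q_def)
    next
      case False
      then have "\<not> i - 1 \<le> n" "i - 1 - n = j - 1" using k by auto
      then show ?thesis by (simp add: q_def)
    qed
    have c: "c \<le> r j" "c \<le> r (j - 1)" using rc[of j] rc[of "j - 1"] k by auto
    have "affine_fun_on {r (j - 1)..r j} ?l \<longleftrightarrow> affine_fun_on {r (j - 1)..r j} h"
      by (rule affine_fun_on_cong, rule lh) (use c in force)
    then show ?thesis using r(3)[OF k(1)] unfolding q q' lh[OF c(1)] lh[OF c(2)] by blast
  qed
  moreover have "q 0 = a" "q (n + m) = b" using s(1,2) r(1,2) m by (auto simp: q_def)
  ultimately show ?thesis unfolding linear_interpolation_def by blast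
qed

lemma linear_interpolation_uminus:
  assumes "linear_interpolation n f a b g"
  shows "linear_interpolation n (\<lambda>x. - f x) a b (\<lambda>x. - g x)"
proof -
  have "affine_fun_on S (\<lambda>x. - g x)" if "affine_fun_on S g" for S
  proof -
    from that obtain c d where "\<forall>x\<in>S. g x = c * x + d" by (auto simp: affine_fun_on_def)
    then show ?thesis unfolding affine_fun_on_def
      by (intro exI[of _ "- c"] exI[of _ "- d"]) auto
  qed
  note aff = this
  obtain s where "s 0 = a" "s n = b"
    "\<forall>i\<in>{1..n}. s (i - 1) < s i \<and> affine_fun_on {s (i - 1)..s i} g \<and>
       g (s (i - 1)) = f (s (i - 1)) \<and> g (s i) = f (s i)"
    using assms unfolding linear_interpolation_def by blast
  with aff show ?thesis
    unfolding linear_interpolation_def neg_equal_iff_equal by (intro exI[of _ s]) blast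
qed

lemma linear_interpolation_reflect:
  assumes "linear_interpolation n (\<lambda>x. f (a + b - x)) a b g"
  shows "linear_interpolation n f a b (\<lambda>x. g (a + b - x))"
proof -
  obtain s where s: "s 0 = a" "s n = b"
    "\<And>i. i \<in> {1..n} \<Longrightarrow> s (i - 1) < s i \<and> affine_fun_on {s (i - 1)..s i} g \<and>
           g (s (i - 1)) = f (a + b - s (i - 1)) \<and> g (s i) = f (a + b - s i)"
    using assms unfolding linear_interpolation_def by blast
  have aff: "affine_fun_on {a + b - v..a + b - u} (\<lambda>x. g (a + b - x))"
    if "affine_fun_on {u..v} g" for u v
  proof -
    from that obtain c d where "\<forall>x\<in>{u..v}. g x = c * x + d" by (auto simp: affine_fun_on_def)
    then show ?thesis unfolding affine_fun_on_def
      by (intro exI[of _ "- c"] exI[of _ "d + c * (a + b)"]) (auto simp: algebra_simps)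
  qed
  define r where "r = (\<lambda>i. a + b - s (n - i))"
  have "r (i - 1) < r i \<and> affine_fun_on {r (i - 1)..r i} (\<lambda>x. g (a + b - x)) \<and>
         g (a + b - r (i - 1)) = f (r (i - 1)) \<and> g (a + b - r i) = f (r i)" if i: "i \<in> {1..n}" for i
  proof -
    \<comment> \<open>Reflection reverses the order of the pieces: the \<open>i\<close>-th piece
      from the left is the image of piece \<open>n + 1 - i\<close>.\<close>
    define j where "j = Suc n - i"
    have j: "j \<in> {1..n}" "r (i - Suc 0) = a + b - s j" "r i = a + b - s (j - Suc 0)"
      using i by (auto simp: j_def r_def Suc_diff_le)
    show ?thesis using s(3)[OF j(1)] aff[of "s (j - Suc 0)" "s j"] by (simp add: j)
  qed
  then show ?thesis unfolding linear_interpolation_def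
    using s(1,2) by (intro exI[of _ r]) (auto simp: r_def)
qed

section \<open>Error of order 1 / n^2 from supporting slopes at the ends\<close>

lemma chord_sub_convex_le:
  fixes f :: "real \<Rightarrow> real"
  assumes "a < b" "x \<in> {a..b}"
    and p: "f a + p * (x - a) \<le> f x" and q: "f b - q * (b - x) \<le> f x" and "p \<le> q"
  shows "f a + (f b - f a) / (b - a) * (x - a) - f x \<le> (q - p) * (b - a) / 4"
proof -
  define L where "L = b - a"
  define t where "t = (x - a) / L"
  have L: "L > 0" "b = a + L" using assms by (auto simp: L_def)
  have t: "0 \<le> t" "t \<le> 1" "x - a = t * L" using assms by (auto simp: t_def L_def field_simps)
  have bx: "b - x = (1 - t) * L" using t(3) L by (simp add: algebra_simps)
  have "(1 - t) * (f a + p * (t * L)) + t * (f b - q * ((1 - t) * L)) \<le> (1 - t) * f x + t * f x"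
    using t p[unfolded t(3)] q[unfolded bx] by (intro add_mono mult_left_mono) simp_all
  moreover have "(f b - f a) / (b - a) * (x - a) = (f b - f a) * t"
    by (simp add: t_def L_def)
  ultimately have "f a + (f b - f a) / (b - a) * (x - a) - f x \<le> (t * (1 - t)) * ((q - p) * L)"
    by (simp add: algebra_simps)
  also have "t * (1 - t) \<le> 1 / 4"
    using zero_le_power2[of "t - 1 / 2"] by (simp add: power2_eq_square algebra_simps)
  then have "(t * (1 - t)) * ((q - p) * L) \<le> 1 / 4 * ((q - p) * L)"
    using assms L by (intro mult_right_mono) auto
  finally show ?thesis by (simp add: L_def)
qed

text \<open>Along the segment from \<open>s\<close> to \<open>y\<close>, convexity makes the
  increment of \<open>f\<close> at most proportional to the step \<open>t\<close>, while the
  quadratic defect is of order \<open>t^2\<close>. Dividing by \<open>t\<close> and letting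
  \<open>t\<close> tend to 0 removes the defect.\<close>

lemma convex_above_tangent_of_quadratic_minorant:
  fixes f :: "real \<Rightarrow> real"
  assumes f: "convex_on S f" and s: "s \<in> S" and y: "y \<in> S"
    and minor: "\<And>x. x \<in> S \<Longrightarrow> f s + m * (x - s) - c * (x - s)\<^sup>2 \<le> f x"
  shows "f s + m * (y - s) \<le> f y"
proof (rule field_le_epsilon)
  fix e :: real assume e: "e > 0"
  define C where "C = \<bar>c\<bar> * (y - s)\<^sup>2 + 1"
  have C: "C > 0" "c * (y - s)\<^sup>2 \<le> C"
    using mult_right_mono[of c "\<bar>c\<bar>" "(y - s)\<^sup>2", OF abs_ge_self] by (auto simp: C_def add_nonneg_pos)
  define t where "t = min 1 (e / C)"
  have t: "0 < t" "t \<le> 1" using e C by (auto simp: t_def)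
  have "t \<le> e / C" by (simp add: t_def)
  then have tC: "t * C \<le> e" using C by (simp add: pos_le_divide_eq)
  define x where "x = (1 - t) *\<^sub>R s + t *\<^sub>R y"
  have "x \<in> S" unfolding x_def
    using convex_on_imp_convex[OF f] s y t by (intro convexD) auto
  have xs: "x - s = t * (y - s)" by (simp add: x_def algebra_simps)
  have "f x \<le> (1 - t) * f s + t * f y"
    unfolding x_def using t s y by (intro convex_onD[OF f]) auto
  with minor[OF \<open>x \<in> S\<close>] have "m * (x - s) - c * (x - s)\<^sup>2 \<le> t * (f y - f s)"
    by (simp add: algebra_simps)
  moreover have "m * (x - s) - c * (x - s)\<^sup>2 = t * (m * (y - s) - t * (c * (y - s)\<^sup>2))"
    unfolding xs power_mult_distrib by (simp add: power2_eq_square algebra_simps)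
  ultimately have "t * (m * (y - s) - t * (c * (y - s)\<^sup>2)) \<le> t * (f y - f s)" by simp
  then have "m * (y - s) - t * (c * (y - s)\<^sup>2) \<le> f y - f s" using t by simp
  moreover have "t * (c * (y - s)\<^sup>2) \<le> t * C" using C t by (intro mult_left_mono) auto
  ultimately show "f s + m * (y - s) \<le> f y + e" using tC by linarith
qed

lemma prod_le_of_sum_eq:
  fixes u v :: real
  assumes "u + v = 2 * r"
  shows "u * v \<le> r\<^sup>2"
proof -
  have v: "v = 2 * r - u" using assms by simp
  show ?thesis using zero_le_power2[of "u - r"] unfolding v by (simp add: power2_eq_square algebra_simps)
qed

text \<open>The slopes at the two ends are optimal for the split point to be interior: it is a minimiser
  of \<open>f\<close> minus a quadratic whose derivative decreases, so that the (normalised) increments of slope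
  and abscissa over the left part sum up to \<open>2 / n\<close>.\<close>

lemma convex_balanced_split:
  fixes f :: "real \<Rightarrow> real"
  assumes ab: "a < b" and f: "convex_on {a..b} f" and cont: "continuous_on {a..b} f"
    and pq: "p < q" and n: "2 \<le> (n::nat)"
    and p: "\<And>x. x \<in> {a..b} \<Longrightarrow> f a + p * (x - a) \<le> f x"
    and q: "\<And>x. x \<in> {a..b} \<Longrightarrow> f b - q * (b - x) \<le> f x"
    and p_opt: "\<And>p'. (\<And>x. x \<in> {a..b} \<Longrightarrow> f a + p' * (x - a) \<le> f x) \<Longrightarrow> p' \<le> p"
    and q_opt: "\<And>q'. (\<And>x. x \<in> {a..b} \<Longrightarrow> f b - q' * (b - x) \<le> f x) \<Longrightarrow> q \<le> q'"
  shows "\<exists>s m. a < s \<and> s < b \<and> p \<le> m \<and> m \<le> q \<and>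
    (\<forall>x\<in>{a..b}. f s + m * (x - s) \<le> f x) \<and>
    (m - p) / (q - p) + (s - a) / (b - a) = 2 / n"
proof -
  define D where "D = q - p"
  define L where "L = b - a"
  have D: "D > 0" and L: "L > 0" using pq ab by (auto simp: D_def L_def)
  define F where "F = (\<lambda>x. f x - (p * x + D * (2 * x / n - (x - a)\<^sup>2 / (2 * L))))"
  have "continuous_on {a..b} F" unfolding F_def
    using L n by (intro continuous_intros cont) auto
  then obtain s where s: "s \<in> {a..b}" "\<And>y. y \<in> {a..b} \<Longrightarrow> F s \<le> F y"
    using continuous_attains_inf[of "{a..b}" F] ab by auto
  \<comment> \<open>This is the derivative at \<open>s\<close> of the function subtracted in
    \<open>F\<close>. It is also the solution of (m - p) / D + (s - a) / L = 2 / n, so the last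
    claim holds by construction once \<open>m\<close> is known to be a supporting slope.\<close>
  define m where "m = p + D * (2 / n - (s - a) / L)"
  have minor: "f s + m * (x - s) - D / (2 * L) * (x - s)\<^sup>2 \<le> f x" if "x \<in> {a..b}" for x
  proof -
    have "(x - a)\<^sup>2 = (s - a)\<^sup>2 + 2 * (s - a) * (x - s) + (x - s)\<^sup>2"
      by (simp add: power2_eq_square algebra_simps)
    then have "(x - a)\<^sup>2 / (2 * L) = (s - a)\<^sup>2 / (2 * L) + (s - a) / L * (x - s) + (x - s)\<^sup>2 / (2 * L)"
      using L by (simp add: field_simps)
    then have "D * ((x - a)\<^sup>2 / (2 * L)) =
        D * ((s - a)\<^sup>2 / (2 * L)) + D * ((s - a) / L) * (x - s) + D / (2 * L) * (x - s)\<^sup>2"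
      by (simp add: algebra_simps)
    moreover have "m * (x - s) = p * x - p * s + D * (2 * x / n) - D * (2 * s / n) - D * ((s - a) / L) * (x - s)"
      by (simp add: m_def algebra_simps diff_divide_distrib)
    ultimately show ?thesis using s(2)[OF that] by (simp add: F_def right_diff_distrib)
  qed
  have tang: "f s + m * (x - s) \<le> f x" if "x \<in> {a..b}" for x
    using convex_above_tangent_of_quadratic_minorant[OF f s(1) that minor] .
  have n1: "2 / real n \<le> 1" "2 / real n > 0" using n by auto
  have as: "a < s"
  proof (rule ccontr)
    assume "\<not> a < s"
    then have sa: "s = a" using s by simp
    then have "m \<le> p" using tang by (intro p_opt) auto
    moreover have "D * (2 / n) > 0" using n1 D by (intro mult_pos_pos) auto
    ultimately show False by (simp add: m_def sa)
  qed
  \<comment> \<open>At \<open>s = b\<close> the slope \<open>m\<close> would be at most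
    \<open>p\<close>, because 2 / n \<le> 1; optimality of \<open>q\<close> would then give
    \<open>q \<le> p\<close>.\<close>
  have sb: "s < b"
  proof (rule ccontr)
    assume "\<not> s < b"
    then have sb: "s = b" using s by simp
    then have "q \<le> m" using tang by (intro q_opt) (auto simp: algebra_simps)
    moreover have "m = p + D * (2 / n - 1)" using sb L by (simp add: m_def L_def)
    moreover have "D * (2 / n - 1) \<le> D * 0" using n1 D by (intro mult_left_mono) auto
    ultimately show False using D by (simp add: D_def)
  qed
  have "p * (s - a) \<le> m * (s - a)"
    using p[of s] tang[of a] as sb by (simp add: algebra_simps)
  then have pm: "p \<le> m" using as by simp
  have "m * (b - s) \<le> q * (b - s)"
    using q[of s] tang[of b] as sb by (simp add: algebra_simps)
  then have mq: "m \<le> q" using sb by simp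
  have "(m - p) / (q - p) + (s - a) / (b - a) = 2 / n"
    using D by (simp add: m_def D_def L_def)
  then show ?thesis using as sb pm mq tang by blast
qed

text \<open>The supremum of the supporting slopes at \<open>a\<close> is itself one; for convex
  \<open>f\<close> it is the right derivative. It is finite because \<open>p0\<close> is a
  supporting slope and the chord over \<open>{a..b}\<close> bounds them all. It provides the optimal
  end slopes that a balanced split requires.\<close>

lemma convex_sharp_left_slope:
  fixes f :: "real \<Rightarrow> real"
  assumes ab: "a < b"
    and p0: "\<And>x. x \<in> {a..b} \<Longrightarrow> f a + p0 * (x - a) \<le> f x"
  shows "\<exists>p\<ge>p0. (\<forall>x\<in>{a..b}. f a + p * (x - a) \<le> f x) \<and>
    (\<forall>p'. (\<forall>x\<in>{a..b}. f a + p' * (x - a) \<le> f x) \<longrightarrow> p' \<le> p)"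
proof -
  define P where "P = {p. \<forall>x\<in>{a..b}. f a + p * (x - a) \<le> f x}"
  have "p \<le> (f b - f a) / (b - a)" if "p \<in> P" for p
    using bspec[OF that[unfolded P_def, simplified], of b] ab by (auto simp: field_simps)
  then have bdd: "bdd_above P" by (rule bdd_aboveI)
  have p0': "p0 \<in> P" using p0 by (simp add: P_def)
  have "f a + Sup P * (x - a) \<le> f x" if x: "x \<in> {a..b}" for x
  proof (cases "x = a")
    case False
    then have "p \<le> (f x - f a) / (x - a)" if "p \<in> P" for p
      using that x by (auto simp: P_def field_simps)
    then have "Sup P \<le> (f x - f a) / (x - a)" using p0' by (intro cSup_least) auto
    with False x show ?thesis by (auto simp: field_simps)
  qed simp
  moreover have "p' \<le> Sup P" if "\<forall>x\<in>{a..b}. f a + p' * (x - a) \<le> f x" for p'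
    using that bdd by (intro cSup_upper) (auto simp: P_def)
  moreover have "p0 \<le> Sup P" using p0' bdd by (rule cSup_upper)
  ultimately show ?thesis by blast
qed

text \<open>Arbitrary supporting slopes \<open>p\<close> and \<open>q\<close> take the place of
  derivatives, so that a tangent slope \<open>m\<close> at the split point can serve on both sides.
  The induction cuts off one piece at the left, and the rest falls under the induction hypothesis
  with \<open>m\<close> as its left slope.\<close>

lemma convex_interpolation_uniform:
  fixes f :: "real \<Rightarrow> real"
  assumes "n \<ge> 1" "a < b" "convex_on {a..b} f" "continuous_on {a..b} f"
    and "\<And>x. x \<in> {a..b} \<Longrightarrow> f a + p * (x - a) \<le> f x"
    and "\<And>x. x \<in> {a..b} \<Longrightarrow> f b - q * (b - x) \<le> f x"
  shows "\<exists>g. linear_interpolation n f a b g \<and>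
           (\<forall>x\<in>{a..b}. \<bar>f x - g x\<bar> \<le> (q - p) * (b - a) / (4 * (real n)\<^sup>2))"
  using assms
proof (induction n arbitrary: a p q rule: nat_induct_at_least)
  case base
  have "p * (b - a) \<le> q * (b - a)" using base(4)[of b] base(5)[of a] base(1) by (simp add: algebra_simps)
  then have pq: "p \<le> q" using base(1) by simp
  let ?g = "\<lambda>x. f a + (f b - f a) / (b - a) * (x - a)"
  have "\<bar>f x - ?g x\<bar> \<le> (q - p) * (b - a) / 4" if x: "x \<in> {a..b}" for x
  proof -
    have "f x \<le> ?g x" by (rule convex_on_le_chord[OF base(2)]) (use x base(1) in auto)
    then show ?thesis
      using chord_sub_convex_le[OF base(1) x base(4)[OF x] base(5)[OF x] pq] by simp
  qed
  then show ?case using linear_interpolation_single[OF base(1), of f] by auto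
next
  case (Suc n)
  note ab = \<open>a < b\<close> and f = \<open>convex_on {a..b} f\<close> and cont = \<open>continuous_on {a..b} f\<close>
  obtain p' where p': "p \<le> p'"
    "\<And>x. x \<in> {a..b} \<Longrightarrow> f a + p' * (x - a) \<le> f x"
    "\<And>r. \<forall>x\<in>{a..b}. f a + r * (x - a) \<le> f x \<Longrightarrow> r \<le> p'"
    using convex_sharp_left_slope[OF ab Suc(6)] by blast
  \<comment> \<open>The right end is treated as the left end of the reflected function. Slopes
    change sign, so the greatest slope \<open>q0\<close> there yields the least slope
    \<open>q' = - q0\<close> here.\<close>
  have "f (a + b - a) + - q * (x - a) \<le> f (a + b - x)" if "x \<in> {a..b}" for x
    using Suc(7)[of "a + b - x"] that by (simp add: algebra_simps)
  from convex_sharp_left_slope[OF ab, of "\<lambda>x. f (a + b - x)", OF this]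
  obtain q0 where q0: "- q \<le> q0"
    "\<And>x. x \<in> {a..b} \<Longrightarrow> f (a + b - a) + q0 * (x - a) \<le> f (a + b - x)"
    "\<And>r. \<forall>x\<in>{a..b}. f (a + b - a) + r * (x - a) \<le> f (a + b - x) \<Longrightarrow> r \<le> q0"
    by blast
  define q' where "q' = - q0"
  have q': "q' \<le> q" "\<And>x. x \<in> {a..b} \<Longrightarrow> f b - q' * (b - x) \<le> f x"
  proof -
    fix x assume "x \<in> {a..b}"
    then show "f b - q' * (b - x) \<le> f x" using q0(2)[of "a + b - x"] by (simp add: q'_def algebra_simps)
  qed (use q0 in \<open>auto simp: q'_def\<close>)
  have q'_opt: "q' \<le> r" if r: "\<And>x. x \<in> {a..b} \<Longrightarrow> f b - r * (b - x) \<le> f x" for r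
  proof -
    have "- r \<le> q0"
    proof (rule q0(3), rule ballI)
      fix x assume "x \<in> {a..b}"
      then show "f (a + b - a) + - r * (x - a) \<le> f (a + b - x)"
        using r[of "a + b - x"] by (simp add: algebra_simps)
    qed
    then show ?thesis by (simp add: q'_def)
  qed
  have "p' * (b - a) \<le> q' * (b - a)" using p'(2)[of b] q'(2)[of a] ab by (simp add: algebra_simps)
  then have pq: "p' \<le> q'" using ab by simp
  define D where "D = q' - p'"
  define L where "L = b - a"
  have L: "L > 0" using ab by (simp add: L_def)
  have DL: "D * L \<le> (q - p) * (b - a)"
    unfolding D_def L_def using p' q' ab by (intro mult_right_mono) auto
  have n: "n \<ge> 1" by fact
  \<comment> \<open>The two product budgets are chosen such that one chord on the left and
    \<open>n\<close> pieces on the right lead to the same error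
    \<open>D * L / (4 * (Suc n)^2)\<close>.\<close>
  have "\<exists>s m. a < s \<and> s < b \<and> p' \<le> m \<and> m \<le> q' \<and> (\<forall>x\<in>{a..b}. f s + m * (x - s) \<le> f x) \<and>
    (m - p') * (s - a) \<le> D * L / (real (Suc n))\<^sup>2 \<and>
    (q' - m) * (b - s) \<le> D * L * ((real n)\<^sup>2 / (real (Suc n))\<^sup>2)"
  \<comment> \<open>For \<open>D = 0\<close> the slope increments cannot be normalised, but
    \<open>f\<close> is then affine, both products vanish with \<open>m = p'\<close>, and any
    interior point will do.\<close>
  proof (cases "D = 0")
    case True
    have lo: "f a + p' * (x - a) \<le> f x" if "x \<in> {a..b}" for x using p'(2)[OF that] .
    have "f x \<le> f a + p' * (x - a)" if "x \<in> {a..b}" for x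
    proof -
      have "f x * (b - a) \<le> f a * (b - x) + f b * (x - a)"
        using convex_on_three_points[OF f] that ab by auto
      also have "f b \<le> f a + p' * (b - a)" using q'(2)[of a] True ab by (simp add: D_def)
      then have "f b * (x - a) \<le> (f a + p' * (b - a)) * (x - a)" using that by (intro mult_right_mono) auto
      finally have "f x * (b - a) \<le> (f a + p' * (x - a)) * (b - a)" by (simp add: algebra_simps)
      then show ?thesis using ab by simp
    qed
    note hi = this
    have eq: "f x = f a + p' * (x - a)" if "x \<in> {a..b}" for x using lo[OF that] hi[OF that] by simp
    show ?thesis
    proof (intro exI conjI ballI)
      show "a < (a + b) / 2" "(a + b) / 2 < b" using ab by auto
      fix x assume "x \<in> {a..b}"
      then show "f ((a + b) / 2) + p' * (x - (a + b) / 2) \<le> f x"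
        using eq[of x] eq[of "(a + b) / 2"] ab by (simp add: algebra_simps diff_divide_distrib add_divide_distrib)
    qed (use pq True in \<open>auto simp: D_def\<close>)
  next
    case False
    then have D: "D > 0" "p' < q'" using pq by (auto simp: D_def)
    have p'_opt: "r \<le> p'" if "\<And>x. x \<in> {a..b} \<Longrightarrow> f a + r * (x - a) \<le> f x" for r
      using that by (intro p'(3)) blast
    obtain s m where sm: "a < s" "s < b" "p' \<le> m" "m \<le> q'"
      "\<And>x. x \<in> {a..b} \<Longrightarrow> f s + m * (x - s) \<le> f x"
      "(m - p') / (q' - p') + (s - a) / (b - a) = 2 / Suc n"
      using convex_balanced_split[OF ab f cont D(2) _ p'(2) q'(2) p'_opt q'_opt, of "Suc n"] n
      by (metis Suc_le_mono one_add_one plus_1_eq_Suc)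
    have DL0: "D * L > 0" using D L by simp
    have sum: "(m - p') / D + (s - a) / L = 2 * (1 / real (Suc n))"
      using sm(6) by (simp add: D_def L_def)
    then have "(m - p') / D * ((s - a) / L) \<le> (1 / real (Suc n))\<^sup>2"
      by (rule prod_le_of_sum_eq)
    then have "(m - p') * (s - a) / (D * L) \<le> 1 / (real (Suc n))\<^sup>2"
      by (simp only: times_divide_times_eq power_divide power_one)
    then have 1: "(m - p') * (s - a) \<le> D * L / (real (Suc n))\<^sup>2"
      unfolding pos_divide_le_eq[OF DL0] by simp
    have "(q' - m) / D = 1 - (m - p') / D"
      using D unfolding D_def by (simp add: divide_simps)
    moreover have "(b - s) / L = 1 - (s - a) / L"
      using L unfolding L_def by (simp add: divide_simps)
    moreover have "1 / real (Suc n) + real n / real (Suc n) = 1"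
      by (simp flip: add_divide_distrib)
    ultimately have "(q' - m) / D + (b - s) / L = 2 * (real n / real (Suc n))"
      using sum by linarith
    then have "(q' - m) / D * ((b - s) / L) \<le> (real n / real (Suc n))\<^sup>2" by (rule prod_le_of_sum_eq)
    then have "(q' - m) * (b - s) / (D * L) \<le> (real n)\<^sup>2 / (real (Suc n))\<^sup>2"
      by (simp only: times_divide_times_eq power_divide)
    then have "(q' - m) * (b - s) \<le> D * L * ((real n)\<^sup>2 / (real (Suc n))\<^sup>2)"
      unfolding pos_divide_le_eq[OF DL0] by (simp only: mult.commute)
    with 1 sm show ?thesis by blast
  qed
  then obtain s m where sm: "a < s" "s < b" "p' \<le> m" "m \<le> q'"
      "\<And>x. x \<in> {a..b} \<Longrightarrow> f s + m * (x - s) \<le> f x"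
      and e1: "(m - p') * (s - a) \<le> D * L / (real (Suc n))\<^sup>2"
      and e2: "(q' - m) * (b - s) \<le> D * L * ((real n)\<^sup>2 / (real (Suc n))\<^sup>2)" by blast
  let ?B = "(q - p) * (b - a) / (4 * (real (Suc n))\<^sup>2)"
  have DLB: "D * L / (4 * (real (Suc n))\<^sup>2) \<le> ?B" using DL by (intro divide_right_mono) auto
  have "\<exists>g. linear_interpolation n f s b g \<and>
           (\<forall>x\<in>{s..b}. \<bar>f x - g x\<bar> \<le> (q' - m) * (b - s) / (4 * (real n)\<^sup>2))"
    by (rule Suc.IH)
      (use sm q' f cont in \<open>auto intro: convex_on_subset continuous_on_subset\<close>)
  then obtain g where g: "linear_interpolation n f s b g"
    "\<And>x. x \<in> {s..b} \<Longrightarrow> \<bar>f x - g x\<bar> \<le> (q' - m) * (b - s) / (4 * (real n)\<^sup>2)" by blast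
  have "(q' - m) * (b - s) / (4 * (real n)\<^sup>2) \<le> D * L * ((real n)\<^sup>2 / (real (Suc n))\<^sup>2) / (4 * (real n)\<^sup>2)"
    using e2 by (intro divide_right_mono) auto
  also have "\<dots> = D * L / (4 * (real (Suc n))\<^sup>2)" using n by simp
  finally have gB: "\<bar>f x - g x\<bar> \<le> ?B" if "x \<in> {s..b}" for x using g(2)[OF that] DLB by linarith
  define h where "h = (\<lambda>x. f a + (f s - f a) / (s - a) * (x - a))"
  have h: "linear_interpolation 1 f a s h"
    unfolding h_def using sm(1) by (rule linear_interpolation_single)
  have hB: "\<bar>f x - h x\<bar> \<le> ?B" if x: "x \<in> {a..s}" for x
  proof -
    have "f x \<le> h x" unfolding h_def by (rule convex_on_le_chord[OF f]) (use x sm in auto)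
    moreover have "h x - f x \<le> (m - p') * (s - a) / 4"
      unfolding h_def using x sm p'(2)[of x] sm(5)[of x]
      by (intro chord_sub_convex_le) (auto simp: algebra_simps)
    ultimately show ?thesis using e1 DLB by simp
  qed
  have "linear_interpolation (1 + n) f a b (\<lambda>x. if x \<le> s then h x else g x)"
    by (rule linear_interpolation_append[OF h g(1)]) (use sm n in auto)
  moreover have "\<bar>f x - (if x \<le> s then h x else g x)\<bar> \<le> ?B" if "x \<in> {a..b}" for x
  proof (cases "x \<le> s")
    case True
    then show ?thesis using hB[of x] that by simp
  next
    case False
    then show ?thesis using gB[of x] that by simp
  qed
  ultimately show ?case unfolding plus_1_eq_Suc by blast
qed

section \<open>Mean error under a modulus\<close>

text \<open>The error is dominated by a measurable function, so that no measurability of the interpolation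
  itself has to be established.\<close>

definition mean_interpolable ::
    "real measure \<Rightarrow> nat \<Rightarrow> (real \<Rightarrow> real) \<Rightarrow> real \<Rightarrow> real \<Rightarrow> real \<Rightarrow> bool" where
  "mean_interpolable Q n f a b B \<longleftrightarrow>
     (\<exists>g \<phi>. linear_interpolation n f a b g \<and> \<phi> \<in> borel_measurable borel \<and>
        (\<forall>x\<in>{a..b}. ennreal \<bar>f x - g x\<bar> \<le> \<phi> x) \<and> (\<integral>\<^sup>+x. \<phi> x \<partial>Q) \<le> ennreal B)"

lemma mean_interpolable_integral_le:
  assumes "mean_interpolable Q n f a b B" "0 \<le> B"
  shows "\<exists>g. linear_interpolation n f a b g \<and> (LINT x:{a..b}|Q. \<bar>f x - g x\<bar>) \<le> B"
proof -
  obtain g \<phi> where g: "linear_interpolation n f a b g"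
    and \<phi>: "\<And>x. x \<in> {a..b} \<Longrightarrow> ennreal \<bar>f x - g x\<bar> \<le> \<phi> x" "(\<integral>\<^sup>+x. \<phi> x \<partial>Q) \<le> ennreal B"
    using assms(1) unfolding mean_interpolable_def by blast
  let ?F = "\<lambda>x. indicator {a..b} x *\<^sub>R \<bar>f x - g x\<bar>"
  have "integral\<^sup>L Q ?F \<le> B"
  \<comment> \<open>A function that is not integrable has Bochner integral 0, so the majorant is
    needed only in the integrable case.\<close>
  proof (cases "integrable Q ?F")
    case True
    then have "ennreal (integral\<^sup>L Q ?F) = (\<integral>\<^sup>+x. ennreal (?F x) \<partial>Q)"
      by (subst nn_integral_eq_integral) auto
    also have "\<dots> \<le> (\<integral>\<^sup>+x. \<phi> x \<partial>Q)"
      using \<phi>(1) by (intro nn_integral_mono) (simp add: indicator_def)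
    finally have "ennreal (integral\<^sup>L Q ?F) \<le> ennreal B" using \<phi>(2) by (rule order_trans)
    then show ?thesis using assms(2) by simp
  qed (use assms(2) in \<open>simp add: not_integrable_integral_eq\<close>)
  with g show ?thesis unfolding set_lebesgue_integral_def by blast
qed

lemma mean_interpolable_mono:
  assumes "mean_interpolable Q n f a b B" "B \<le> B'"
  shows "mean_interpolable Q n f a b B'"
  using assms order_trans[OF _ ennreal_leI[OF assms(2)]] unfolding mean_interpolable_def by blast

text \<open>The majorants take values in \<open>ennreal\<close>, hence are nonnegative everywhere.
  Their sum dominates the error on both sides of \<open>c\<close> without any truncation.\<close>

lemma mean_interpolable_append:
  assumes Q: "sets Q = sets borel"
    and l: "mean_interpolable Q n f a c B" and r: "mean_interpolable Q m f c b C"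
    and "a \<le> c" "m > 0" "n > 0" "0 \<le> B" "0 \<le> C"
  shows "mean_interpolable Q (n + m) f a b (B + C)"
proof -
  obtain g \<phi> where g: "linear_interpolation n f a c g" and \<phi>: "\<phi> \<in> borel_measurable borel"
    "\<And>x. x \<in> {a..c} \<Longrightarrow> ennreal \<bar>f x - g x\<bar> \<le> \<phi> x" "(\<integral>\<^sup>+x. \<phi> x \<partial>Q) \<le> ennreal B"
    using l unfolding mean_interpolable_def by blast
  obtain h \<psi> where h: "linear_interpolation m f c b h" and \<psi>: "\<psi> \<in> borel_measurable borel"
    "\<And>x. x \<in> {c..b} \<Longrightarrow> ennreal \<bar>f x - h x\<bar> \<le> \<psi> x" "(\<integral>\<^sup>+x. \<psi> x \<partial>Q) \<le> ennreal C"
    using r unfolding mean_interpolable_def by blast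
  let ?l = "\<lambda>x. if x \<le> c then g x else h x"
  have lin: "linear_interpolation (n + m) f a b ?l"
    using assms by (intro linear_interpolation_append[OF g h])
  have meas: "(\<lambda>x. \<phi> x + \<psi> x) \<in> borel_measurable borel" using \<phi>(1) \<psi>(1) by simp
  have dom: "ennreal \<bar>f x - ?l x\<bar> \<le> \<phi> x + \<psi> x" if "x \<in> {a..b}" for x
  proof (cases "x \<le> c")
    case True
    then show ?thesis using that \<phi>(2)[of x] by (simp add: add_increasing2)
  next
    case False
    then show ?thesis using that \<psi>(2)[of x] by (simp add: add_increasing)
  qed
  have "\<phi> \<in> borel_measurable Q" "\<psi> \<in> borel_measurable Q"
    using \<phi>(1) \<psi>(1) measurable_cong_sets[OF Q refl] by auto
  then have "(\<integral>\<^sup>+x. \<phi> x + \<psi> x \<partial>Q) = (\<integral>\<^sup>+x. \<phi> x \<partial>Q) + (\<integral>\<^sup>+x. \<psi> x \<partial>Q)"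
    by (rule nn_integral_add)
  also have "\<dots> \<le> ennreal B + ennreal C" using \<phi>(3) \<psi>(3) by (rule add_mono)
  also have "\<dots> = ennreal (B + C)" using assms by simp
  finally show ?thesis unfolding mean_interpolable_def using lin meas dom by blast
qed

lemma mean_interpolable_uminus:
  assumes "mean_interpolable Q n (\<lambda>x. - f x) a b B"
  shows "mean_interpolable Q n f a b B"
proof -
  obtain g \<phi> where g: "linear_interpolation n (\<lambda>x. - f x) a b g" and \<phi>: "\<phi> \<in> borel_measurable borel"
    "\<And>x. x \<in> {a..b} \<Longrightarrow> ennreal \<bar>- f x - g x\<bar> \<le> \<phi> x" "(\<integral>\<^sup>+x. \<phi> x \<partial>Q) \<le> ennreal B"
    using assms unfolding mean_interpolable_def by blast
  have "linear_interpolation n f a b (\<lambda>x. - g x)"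
    using linear_interpolation_uminus[OF g] by simp
  moreover have "\<bar>f x - - g x\<bar> = \<bar>- f x - g x\<bar>" for x by linarith
  then have "\<forall>x\<in>{a..b}. ennreal \<bar>f x - - g x\<bar> \<le> \<phi> x" using \<phi>(2) by simp
  ultimately show ?thesis unfolding mean_interpolable_def using \<phi>(1,3) by blast
qed

text \<open>Reflecting the function alone would change the mean error; the measure is reflected with
  it, and the change of variables gives the same integral.\<close>

lemma mean_interpolable_reflect:
  assumes Q: "sets Q = sets borel"
    and f: "mean_interpolable (distr Q borel (\<lambda>x. a + b - x)) n (\<lambda>x. f (a + b - x)) a b B"
  shows "mean_interpolable Q n f a b B"
proof -
  let ?r = "\<lambda>x. a + b - x"
  obtain g \<phi> where g: "linear_interpolation n (\<lambda>x. f (?r x)) a b g"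
    and \<phi>[measurable]: "\<phi> \<in> borel_measurable borel"
    and \<phi>': "\<And>x. x \<in> {a..b} \<Longrightarrow> ennreal \<bar>f (?r x) - g x\<bar> \<le> \<phi> x"
      "(\<integral>\<^sup>+x. \<phi> x \<partial>distr Q borel ?r) \<le> ennreal B"
    using f unfolding mean_interpolable_def by blast
  have r: "?r \<in> measurable Q borel"
    by (subst measurable_cong_sets[OF Q refl]) measurable
  have "(\<integral>\<^sup>+x. \<phi> (?r x) \<partial>Q) \<le> ennreal B"
    using \<phi>'(2) by (simp add: nn_integral_distr[OF r])
  moreover have "ennreal \<bar>f x - g (?r x)\<bar> \<le> \<phi> (?r x)" if "x \<in> {a..b}" for x
    using \<phi>'(1)[of "?r x"] that by simp
  moreover have "(\<lambda>x. \<phi> (?r x)) \<in> borel_measurable borel" by measurable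
  ultimately show ?thesis
    unfolding mean_interpolable_def using linear_interpolation_reflect[OF g] by blast
qed

lemma mean_interpolable_uniform:
  assumes "prob_space Q" "linear_interpolation n f a b g" "\<And>x. x \<in> {a..b} \<Longrightarrow> \<bar>f x - g x\<bar> \<le> B"
  shows "mean_interpolable Q n f a b B"
proof -
  have "(\<integral>\<^sup>+x. ennreal B \<partial>Q) \<le> ennreal B" by (simp add: prob_space.emeasure_space_1[OF assms(1)])
  moreover have "\<forall>x\<in>{a..b}. ennreal \<bar>f x - g x\<bar> \<le> ennreal B" using assms(3) by (simp add: ennreal_leI)
  ultimately show ?thesis
    unfolding mean_interpolable_def using assms(2) by (intro exI[of _ g] exI[of _ "\<lambda>_. ennreal B"]) simp
qed

section \<open>Increments of \<open>Psi\<close>\<close>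

lemma Psi_diff_eq:
  assumes "Psi_finite w" "0 \<le> x" "x \<le> y"
  shows "Psi w y - Psi w x = (LBINT t:{x<..y}. modulus_integrand w t)"
    and "set_integrable lborel {x<..y} (modulus_integrand w)"
proof -
  have int: "set_integrable lborel {0<..u} (modulus_integrand w)" if "0 \<le> u" for u
    using assms(1) that unfolding Psi_finite_def by (cases "u = 0") (auto simp: set_integrable_def)
  have y: "0 \<le> y" using assms by simp
  show i: "set_integrable lborel {x<..y} (modulus_integrand w)"
    by (rule set_integrable_subset[OF int[OF y]]) (use assms in auto)
  have "{0<..y} = {0<..x} \<union> {x<..y}" using assms by auto
  then have "Psi w y = (LBINT t:{0<..x} \<union> {x<..y}. modulus_integrand w t)" by (simp add: Psi_def)
  also have "\<dots> = Psi w x + (LBINT t:{x<..y}. modulus_integrand w t)"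
    unfolding Psi_def by (rule set_integral_Un[OF _ int[OF assms(2)] i]) auto
  finally show "Psi w y - Psi w x = (LBINT t:{x<..y}. modulus_integrand w t)" by simp
qed

lemma Psi_mono:
  assumes w: "mono_on {0..} w" and fin: "Psi_finite w" and xy: "0 \<le> x" "x \<le> y"
  shows "Psi w x \<le> Psi w y"
proof -
  have "0 \<le> modulus_integrand w t" if "t \<in> {x<..y}" for t
    using mono_onD[OF w, of 0 t] that xy by (auto simp: modulus_integrand_def)
  then have "0 \<le> (LBINT t:{x<..y}. modulus_integrand w t)"
    unfolding set_lebesgue_integral_def
    by (intro Bochner_Integration.integral_nonneg) (auto simp: indicator_def)
  with Psi_diff_eq(1)[OF fin xy] show ?thesis by simp
qed

text \<open>On \<open>{x<..y}\<close> monotonicity of \<open>w\<close> keeps the integrand above (w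
  x - w 0) / y, and the length y - x turns this into the factor 1 - x / y. With x / y = \<delta> / c
  this is the relative gap between a chord slope c and the slope \<delta> at the flat end.\<close>

lemma Psi_diff_ge:
  assumes w: "mono_on {0..} w" and fin: "Psi_finite w" and xy: "0 < x" "x \<le> y"
  shows "(w x - w 0) * (1 - x / y) \<le> Psi w y - Psi w x"
proof -
  have x: "0 \<le> x" using xy by simp
  note d = Psi_diff_eq[OF fin x xy(2)]
  have "(w x - w 0) / y \<le> modulus_integrand w t" if "t \<in> {x<..y}" for t
  proof -
    have "w 0 \<le> w x" "w x \<le> w t" using w that xy by (auto intro: mono_onD)
    then show ?thesis unfolding modulus_integrand_def using that xy by (intro frac_le) auto
  qed
  moreover have "set_integrable lborel {x<..y} (\<lambda>_. (w x - w 0) / y)"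
    unfolding set_integrable_def using xy
    by (intro integrable_scaleR_left integrable_real_indicator) auto
  ultimately have "(LBINT t:{x<..y}. (w x - w 0) / y) \<le> (LBINT t:{x<..y}. modulus_integrand w t)"
    by (intro set_integral_mono d(2)) auto
  moreover have "(LBINT t:{x<..y}. (w x - w 0) / y) = (y - x) * ((w x - w 0) / y)"
    unfolding set_lebesgue_integral_def using xy
    by (subst Bochner_Integration.integral_scaleR_left) (auto intro: integrable_real_indicator)
  moreover have "(y - x) * ((w x - w 0) / y) = (w x - w 0) * (1 - x / y)"
    using xy by (simp add: divide_simps)
  ultimately show ?thesis unfolding d(1) by linarith
qed

section \<open>Mean errors for a measure with a modulus\<close>

lemma concave_supergradient:
  assumes "concave_on {0..} (w :: real \<Rightarrow> real)" "0 < v"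
  obtains m where "\<And>u. 0 \<le> u \<Longrightarrow> w u \<le> w v + m * (u - v)"
proof -
  let ?w = "\<lambda>x. - w x"
  let ?m = "Inf ((\<lambda>t. (?w v - ?w t) / (v - t)) ` ({v<..} \<inter> {0..}))"
  have conv: "convex_on {0..} ?w" using assms(1) by (simp add: concave_on_def)
  have v: "v \<in> interior {0..}" using assms(2) by (simp add: interior_real_atLeast)
  have "?w v + ?m * (u - v) \<le> ?w u" if "0 \<le> u" for u
    using convex_le_Inf_differential[OF conv v, of u] that by simp
  then have "w u \<le> w v + (- ?m) * (u - v)" if "0 \<le> u" for u using that by fastforce
  then show ?thesis by (rule that)
qed

text \<open>The modulus inequality is kept for closed intervals and in terms of their length. Both
  survive a reflection of the measure, so the estimates proved here can be instantiated again for
  the reflected \<open>Q\<close>.\<close>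

locale measure_modulus = prob_space Q for Q :: "real measure" +
  fixes w :: "real \<Rightarrow> real"
  assumes sets_Q [measurable_cong]: "sets Q = sets borel"
    and w_nonneg: "\<And>u. 0 \<le> u \<Longrightarrow> 0 \<le> w u"
    and w_mono: "mono_on {0..} w"
    and w_concave: "concave_on {0..} w"
    and Q_le: "\<And>u v. u \<le> v \<Longrightarrow> emeasure Q {u..v} \<le> ennreal (w (v - u))"
    and Psi_fin: "Psi_finite w"
begin

lemma measure_modulus_reflect: "measure_modulus (distr Q borel (\<lambda>x. c - x)) w"
proof -
  have r [measurable]: "(\<lambda>x. c - x) \<in> measurable Q borel" by measurable
  have "emeasure (distr Q borel (\<lambda>x. c - x)) {u..v} \<le> ennreal (w (v - u))" if "u \<le> v" for u v
  proof -
    have "(\<lambda>x. c - x) -` {u..v} \<inter> space Q = {c - v..c - u}"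
      using sets_eq_imp_space_eq[OF sets_Q] by auto
    then show ?thesis using Q_le[of "c - v" "c - u"] that by (simp add: emeasure_distr)
  qed
  then show ?thesis
    using prob_space_distr[OF r] w_nonneg w_mono w_concave Psi_fin
    by (simp add: measure_modulus_def measure_modulus_axioms_def)
qed

text \<open>By Fubini the integral of \<open>t - x\<close> is the integral over \<open>y\<close> of the mass of \<open>{s..y}\<close>;
  concavity of \<open>w\<close> allows to replace the mean of \<open>w (y - s)\<close> by the value at the mean.\<close>

lemma nn_integral_wedge_le:
  assumes st: "s < t"
  shows "(\<integral>\<^sup>+x. indicator {s..t} x * ennreal (t - x) \<partial>Q) \<le> ennreal ((t - s) * w ((t - s) / 2))"
proof -
  define v where "v = (t - s) / 2"
  \<comment> \<open>The affine majorant of \<open>w\<close> touches it at half the length. Its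
    integral over the interval is the length times the value at the midpoint, hence exactly
    \<open>(t - s) * w v\<close>; the slope \<open>m\<close> cancels.\<close>
  obtain m where m: "\<And>u. 0 \<le> u \<Longrightarrow> w u \<le> w v + m * (u - v)"
    using concave_supergradient[OF w_concave, of v] st by (auto simp: v_def)
  interpret P: pair_sigma_finite Q lborel ..
  define S where "S = {p :: real \<times> real. s \<le> fst p \<and> fst p \<le> snd p \<and> snd p \<le> t}"
  have S: "S \<in> sets (Q \<Otimes>\<^sub>M lborel)"
  proof -
    have "S = {p \<in> space (Q \<Otimes>\<^sub>M lborel). s \<le> fst p \<and> fst p \<le> snd p \<and> snd p \<le> t}"
      using sets_eq_imp_space_eq[OF sets_Q] by (auto simp: S_def space_pair_measure)
    also have "\<dots> \<in> sets (Q \<Otimes>\<^sub>M lborel)" by measurable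
    finally show ?thesis .
  qed
  have "(\<integral>\<^sup>+x. indicator {s..t} x * ennreal (t - x) \<partial>Q) =
      (\<integral>\<^sup>+x. (\<integral>\<^sup>+y. indicator S (x, y) \<partial>lborel) \<partial>Q)"
  proof (rule nn_integral_cong)
    fix x
    have "(\<integral>\<^sup>+y. indicator S (x, y) \<partial>lborel) =
        (\<integral>\<^sup>+y. indicator {s..t} x * indicator {x..t} y \<partial>lborel)"
      by (rule nn_integral_cong) (auto simp: S_def indicator_def)
    also have "\<dots> = indicator {s..t} x * emeasure lborel {x..t}"
      by (simp add: nn_integral_cmult)
    also have "\<dots> = indicator {s..t} x * ennreal (t - x)" by (auto simp: indicator_def)
    finally show "indicator {s..t} x * ennreal (t - x) = (\<integral>\<^sup>+y. indicator S (x, y) \<partial>lborel)" ..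
  qed
  also have "\<dots> = (\<integral>\<^sup>+y. (\<integral>\<^sup>+x. indicator S (x, y) \<partial>Q) \<partial>lborel)"
    using P.Fubini[of "indicator S"] S by simp
  also have "\<dots> \<le> (\<integral>\<^sup>+y. ennreal (w v + m * (y - s - v)) * indicator {s..t} y \<partial>lborel)"
  proof (rule nn_integral_mono)
    fix y :: real
    have "(\<integral>\<^sup>+x. indicator S (x, y) \<partial>Q) = (\<integral>\<^sup>+x. indicator {s..t} y * indicator {s..y} x \<partial>Q)"
      by (rule nn_integral_cong) (auto simp: S_def indicator_def)
    also have "\<dots> = indicator {s..t} y * emeasure Q {s..y}"
      by (simp add: nn_integral_cmult)
    also have "\<dots> \<le> indicator {s..t} y * ennreal (w v + m * (y - s - v))"
    proof (cases "y \<in> {s..t}")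
      case True
      then have "emeasure Q {s..y} \<le> ennreal (w (y - s))" by (intro Q_le) simp
      also have "\<dots> \<le> ennreal (w v + m * (y - s - v))" using True by (intro ennreal_leI m) simp
      finally show ?thesis using True by simp
    qed simp
    finally show "(\<integral>\<^sup>+x. indicator S (x, y) \<partial>Q) \<le> ennreal (w v + m * (y - s - v)) * indicator {s..t} y"
      by (simp add: mult.commute)
  qed
  also have "\<dots> = ennreal ((w v * t + m * ((t - s)\<^sup>2 / 2 - v * t)) - (w v * s + m * ((s - s)\<^sup>2 / 2 - v * s)))"
  proof (rule nn_integral_FTC_Icc)
    fix y assume y: "y \<in> {s..t}"
    show "((\<lambda>y. w v * y + m * ((y - s)\<^sup>2 / 2 - v * y)) has_real_derivative w v + m * (y - s - v)) (at y)"
      by (auto intro!: derivative_eq_intros)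
    show "0 \<le> w v + m * (y - s - v)" using m[of "y - s"] w_nonneg[of "y - s"] y by simp
  qed (use st in auto)
  also have "(w v * t + m * ((t - s)\<^sup>2 / 2 - v * t)) - (w v * s + m * ((s - s)\<^sup>2 / 2 - v * s)) = (t - s) * w v"
    by (simp add: v_def power2_eq_square field_simps)
  finally show ?thesis by (simp add: v_def)
qed

text \<open>A concave \<open>f\<close> lies between its chord and the line of slope \<open>q\<close>
  through the end \<open>t\<close>. Both pass through (t, f t), so the error is at most the
  difference of the slopes times \<open>t - x\<close>. Nothing is assumed about the slope at
  \<open>s\<close>.\<close>

lemma mean_interpolable_chord:
  assumes st: "s < t" and f: "concave_on {s..t} f"
    and q: "\<And>x. x \<in> {s..t} \<Longrightarrow> f x \<le> f t - q * (t - x)"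
  shows "mean_interpolable Q 1 f s t (((f t - f s) / (t - s) - q) * ((t - s) * w ((t - s) / 2)))"
proof -
  define c where "c = (f t - f s) / (t - s)"
  define k where "k = c - q"
  have cs: "c * (t - s) = f t - f s" using st by (simp add: c_def)
  have "q * (t - s) \<le> c * (t - s)" unfolding cs using q[of s] st by simp
  then have k: "0 \<le> k" unfolding k_def using st by simp
  define g where "g = (\<lambda>x. f s + c * (x - s))"
  have dom: "ennreal \<bar>f x - g x\<bar> \<le> ennreal k * (indicator {s..t} x * ennreal (t - x))" if x: "x \<in> {s..t}" for x
  proof -
    have "- f x \<le> - f s + (- f t - - f s) / (t - s) * (x - s)"
      by (rule convex_on_le_chord[of "{s..t}" "\<lambda>x. - f x"]) (use f st x in \<open>auto simp: concave_on_def\<close>)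
    also have "(- f t - - f s) / (t - s) = - c"
      unfolding c_def by (simp only: minus_diff_minus minus_divide_left)
    finally have "g x \<le> f x" by (simp add: g_def)
    moreover have "g x = f t - c * (t - x)" using cs by (simp add: g_def algebra_simps)
    then have "f x - g x \<le> k * (t - x)"
      using q[OF x] by (simp add: k_def left_diff_distrib)
    ultimately show ?thesis using x k by (simp add: ennreal_leI flip: ennreal_mult)
  qed
  have "(\<integral>\<^sup>+x. ennreal k * (indicator {s..t} x * ennreal (t - x)) \<partial>Q) =
      ennreal k * (\<integral>\<^sup>+x. indicator {s..t} x * ennreal (t - x) \<partial>Q)"
    by (rule nn_integral_cmult) measurable
  also have "\<dots> \<le> ennreal k * ennreal ((t - s) * w ((t - s) / 2))"
    by (intro mult_left_mono nn_integral_wedge_le st) simp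
  also have "\<dots> = ennreal (k * ((t - s) * w ((t - s) / 2)))"
    using k by (simp add: ennreal_mult')
  finally have int: "(\<integral>\<^sup>+x. ennreal k * (indicator {s..t} x * ennreal (t - x)) \<partial>Q) \<le> \<dots>" .
  have "linear_interpolation 1 f s t g"
    unfolding g_def c_def using st by (rule linear_interpolation_single)
  moreover have "(\<lambda>x. ennreal k * (indicator {s..t} x * ennreal (t - x))) \<in> borel_measurable borel"
    by measurable
  ultimately show ?thesis using dom int unfolding mean_interpolable_def c_def[symmetric] k_def[symmetric] by blast
qed

text \<open>Put x = h / (2 c) and y = h / (2 \<delta>). Then L / 2 \<le> x because c L \<le> h, and
  (c - \<delta>) L = c L (1 - x / y) produces the factor of \<open>Psi_diff_ge\<close>. The constant
  part \<open>w 0\<close> is split off and its coefficient 1 - \<delta> / c is bounded by 1.\<close>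

lemma chord_bound_le:
  assumes L: "0 < L" and d: "0 < \<delta>" "\<delta> \<le> c" and v: "c * L \<le> h"
  shows "(c - \<delta>) * (L * w (L / 2)) \<le> c * L * w 0 + h * (Psi w (h / (2 * \<delta>)) - Psi w (h / (2 * c)))"
    (is "_ \<le> _ + h * ?P")
proof -
  define x where "x = h / (2 * c)"
  define y where "y = h / (2 * \<delta>)"
  have c: "0 < c" using d by simp
  have h: "0 < h" using v mult_pos_pos[OF c L] by simp
  have Lx: "L / 2 \<le> x" unfolding x_def using c v by (simp add: pos_le_divide_eq mult.commute)
  have xy: "0 < x" "x \<le> y" unfolding x_def y_def using h d c by (auto intro: divide_left_mono)
  have r: "x / y = \<delta> / c" unfolding x_def y_def using h d c by simp
  have r1: "0 \<le> 1 - \<delta> / c" "1 - \<delta> / c \<le> 1" using d c by auto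
  have cL: "0 \<le> c * L" using c L by simp
  have w0: "0 \<le> w 0" "w 0 \<le> w x" "w (L / 2) \<le> w x"
    using w_nonneg[of 0] mono_onD[OF w_mono, of 0 x] mono_onD[OF w_mono, of "L / 2" x] xy Lx L by auto
  have "(c - \<delta>) * (L * w (L / 2)) = c * L * (1 - \<delta> / c) * w (L / 2)"
    using c by (simp add: algebra_simps)
  also have "\<dots> \<le> c * L * (1 - \<delta> / c) * w x"
    using w0 by (intro mult_left_mono mult_nonneg_nonneg[OF cL r1(1)])
  also have "\<dots> = (1 - \<delta> / c) * (c * L * w 0) + c * L * ((w x - w 0) * (1 - x / y))"
    unfolding r by (simp add: algebra_simps)
  also have "\<dots> \<le> 1 * (c * L * w 0) + h * ((w x - w 0) * (1 - x / y))"
  proof (intro add_mono mult_right_mono)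
    show "0 \<le> c * L * w 0" using cL w0(1) by (rule mult_nonneg_nonneg)
    show "0 \<le> (w x - w 0) * (1 - x / y)" unfolding r using r1(1) w0(2) by simp
  qed (use r1 v in auto)
  also have "\<dots> \<le> 1 * (c * L * w 0) + h * ?P"
    using Psi_diff_ge[OF w_mono Psi_fin xy] h unfolding x_def[symmetric] y_def[symmetric]
    by (intro add_left_mono mult_left_mono) auto
  finally show ?thesis by simp
qed

text \<open>The subdivision has equal increments of \<open>f\<close>; the slope of each chord bounds \<open>f\<close> on the pieces to
  its left, so that the contributions of \<open>\<Psi>\<close> telescope.\<close>

lemma mean_interpolable_steep:
  assumes "n \<ge> 1" "s < t" "concave_on {s..t} f" "continuous_on {s..t} f"
    and "0 < \<delta>" "\<And>x. x \<in> {s..t} \<Longrightarrow> f x \<le> f t - \<delta> * (t - x)"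
    and "f t - f s \<le> h * real n" "0 \<le> z"
    and "\<And>x y. s \<le> x \<Longrightarrow> x < y \<Longrightarrow> y \<le> t \<Longrightarrow> 2 * z * (f y - f x) \<le> h * (y - x)"
  shows "mean_interpolable Q n f s t ((f t - f s) * w 0 + h * (Psi w (h / (2 * \<delta>)) - Psi w z))"
  using assms
proof (induction n arbitrary: t \<delta> rule: nat_induct_at_least)
  case base
  define L where "L = t - s"
  define c where "c = (f t - f s) / L"
  have L: "0 < L" using base(1) by (simp add: L_def)
  have v: "c * L = f t - f s" using L by (simp add: c_def)
  have "\<delta> * L \<le> c * L" unfolding v using base(5)[of s] base(1) by (simp add: L_def)
  then have c: "\<delta> \<le> c" "0 < c" using L base(4) by auto
  have h: "c * L \<le> h" using base(6) v by simp
  then have h0: "0 < h" using mult_pos_pos[OF c(2) L] by simp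
  \<comment> \<open>The slope hypothesis, applied to the chord itself, says that \<open>z\<close> is
    at most h / (2 c); hence the lower argument of \<open>Psi\<close> may be replaced by
    \<open>z\<close>.\<close>
  have "2 * z * (c * L) \<le> h * L" using base(8)[of s t] base(1) unfolding v by (simp add: L_def)
  then have "(2 * z * c) * L \<le> h * L" by (simp only: mult.assoc)
  then have "2 * z * c \<le> h" using L by (simp only: mult_le_cancel_right_pos)
  then have "z \<le> h / (2 * c)" using c by (simp add: pos_le_divide_eq mult_ac)
  then have "Psi w z \<le> Psi w (h / (2 * c))" by (rule Psi_mono[OF w_mono Psi_fin base(7)])
  then have "h * (Psi w (h / (2 * \<delta>)) - Psi w (h / (2 * c))) \<le> h * (Psi w (h / (2 * \<delta>)) - Psi w z)"
    using h0 by (intro mult_left_mono) auto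
  then have "(c - \<delta>) * (L * w (L / 2)) \<le> (f t - f s) * w 0 + h * (Psi w (h / (2 * \<delta>)) - Psi w z)"
    using chord_bound_le[OF L base(4) c(1) h] unfolding v by linarith
  with mean_interpolable_chord[OF base(1,2,5)] show ?case
    unfolding c_def L_def by (rule mean_interpolable_mono)
next
  case (Suc n)
  note st = Suc(3) and conc = Suc(4) and cont = Suc(5) and d = Suc(6) and tang = Suc(7)
    and h = Suc(8) and z = Suc(9) and slope = Suc(10)
  define V where "V = f t - f s"
  have "0 < \<delta> * (t - s)" using d st by simp
  then have V: "0 < V" using tang[of s] st by (simp add: V_def)
  define v where "v = V / real (Suc n)"
  have n: "1 \<le> real n" using Suc(1) by simp
  have v0: "0 < v" "v < V" using V n by (auto simp: v_def divide_less_eq)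
  \<comment> \<open>The actual height \<open>v\<close> of a piece may be smaller than the budget
    \<open>h\<close>. All arguments of \<open>Psi\<close> are formed with the same \<open>h\<close>,
    which stays fixed along the induction; this is what lets the increments telescope.\<close>
  have vh: "v \<le> h" using h unfolding v_def V_def[symmetric] by (subst pos_divide_le_eq) auto
  have nv: "V - v = v * real n" unfolding v_def by (simp add: divide_simps) (simp add: algebra_simps)
  obtain r where r0: "s \<le> r" "r \<le> t" "f r = f t - v"
    using IVT'[of f s "f t - v" t] cont st v0 by (auto simp: V_def)
  have r: "s < r" "r < t"
  proof -
    show "s < r" using r0 v0 by (cases "r = s") (auto simp: V_def)
    show "r < t" using r0 v0 by (cases "r = t") auto
  qed
  define L where "L = t - r"
  define c where "c = v / L"
  have L: "0 < L" using r by (simp add: L_def)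
  have cL: "c * L = v" using L by (simp add: c_def)
  have "\<delta> * L \<le> c * L" unfolding cL using tang[of r] r r0 by (simp add: L_def)
  then have c: "\<delta> \<le> c" "0 < c" using L d by auto
  have sub: "{s..r} \<subseteq> {s..t}" "{r..t} \<subseteq> {s..t}" using r by auto
  have conc': "concave_on {s..r} f" "concave_on {r..t} f"
    using conc sub unfolding concave_on_def by (auto intro: convex_on_subset)
  have left: "f x \<le> f r - c * (r - x)" if x: "x \<in> {s..r}" for x
  proof -
    have "- f r * (t - x) \<le> - f x * (t - r) + - f t * (r - x)"
      using convex_on_three_points[of "{s..t}" "\<lambda>x. - f x" x t r] conc x r by (simp add: concave_on_def)
    then have "f x * (t - r) \<le> f r * (t - r) - (f t - f r) * (r - x)"
      by (simp add: algebra_simps)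
    also have "f t - f r = c * (t - r)" using cL r0 by (simp add: L_def)
    also have "f r * (t - r) - c * (t - r) * (r - x) = (f r - c * (r - x)) * (t - r)"
      by (simp add: algebra_simps)
    finally show ?thesis using r by simp
  qed
  have vn: "f r - f s \<le> h * real n"
  proof -
    have "f r - f s = v * real n" using r0 nv by (simp add: V_def)
    also have "\<dots> \<le> h * real n" using vh by (rule mult_right_mono) simp
    finally show ?thesis .
  qed
  have slope': "2 * z * (f y - f x) \<le> h * (y - x)" if "s \<le> x" "x < y" "y \<le> r" for x y
    using slope[of x y] that r by simp
  let ?B = "(f r - f s) * w 0 + h * (Psi w (h / (2 * c)) - Psi w z)"
  let ?C = "c * L * w 0 + h * (Psi w (h / (2 * \<delta>)) - Psi w (h / (2 * c)))"
  have B: "mean_interpolable Q n f s r ?B"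
    by (rule Suc.IH[OF r(1) conc'(1) continuous_on_subset[OF cont sub(1)] c(2) left vn z slope'])
  have "mean_interpolable Q 1 f r t (((f t - f r) / (t - r) - \<delta>) * ((t - r) * w ((t - r) / 2)))"
    by (rule mean_interpolable_chord[OF r(2) conc'(2)]) (use tang r in auto)
  moreover have "(f t - f r) / (t - r) = c" using r0 by (simp add: c_def L_def)
  ultimately have C: "mean_interpolable Q 1 f r t ?C"
    using chord_bound_le[OF L d c(1), of h] vh unfolding cL L_def[symmetric]
    by (auto intro: mean_interpolable_mono)
  have h0: "0 < h" using v0 vh by simp
  have w0: "0 \<le> w 0" by (rule w_nonneg) simp
  have "2 * z * (f t - f r) \<le> h * (t - r)" using slope[of r t] r by simp
  then have "2 * z * (c * L) \<le> h * L" unfolding cL using r0 by (simp add: L_def)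
  then have "(2 * z * c) * L \<le> h * L" by (simp only: mult.assoc)
  then have "2 * z * c \<le> h" using L by (simp only: mult_le_cancel_right_pos)
  then have "z \<le> h / (2 * c)" using c by (simp add: pos_le_divide_eq mult_ac)
  then have "Psi w z \<le> Psi w (h / (2 * c))" by (rule Psi_mono[OF w_mono Psi_fin z])
  moreover have "Psi w (h / (2 * c)) \<le> Psi w (h / (2 * \<delta>))"
    using c d h0 by (intro Psi_mono[OF w_mono Psi_fin] divide_left_mono) auto
  moreover have "0 \<le> f r - f s" using r0 v0 by (simp add: V_def)
  ultimately have "0 \<le> ?B" "0 \<le> ?C" using h0 w0 cL v0 by auto
  then have "mean_interpolable Q (n + 1) f s t (?B + ?C)"
    by (intro mean_interpolable_append[OF sets_Q B C]) (use r Suc(1) in auto)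
  moreover have "?B + ?C = (f t - f s) * w 0 + h * (Psi w (h / (2 * \<delta>)) - Psi w z)"
    unfolding cL r0(3) by (simp add: algebra_simps)
  ultimately show ?case by simp
qed

text \<open>The uniform bound is applied to the convex function - f, whose supporting slopes at the
  two ends are -\<delta> and -m. The total mass 1 of \<open>Q\<close> turns it into a bound on the
  mean.\<close>

lemma mean_interpolable_shallow:
  assumes "n \<ge> 1" "c < b" "concave_on {c..b} f" "continuous_on {c..b} f"
    and "\<And>x. x \<in> {c..b} \<Longrightarrow> f x \<le> f c + \<delta> * (x - c)"
    and "\<And>x. x \<in> {c..b} \<Longrightarrow> m * (b - x) \<le> f b - f x"
  shows "mean_interpolable Q n f c b ((\<delta> - m) * (b - c) / (4 * (real n)\<^sup>2))"
proof -
  have "\<exists>g. linear_interpolation n (\<lambda>x. - f x) c b g \<and>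
      (\<forall>x\<in>{c..b}. \<bar>- f x - g x\<bar> \<le> (- m - - \<delta>) * (b - c) / (4 * (real n)\<^sup>2))"
  proof (rule convex_interpolation_uniform[OF assms(1,2)])
    show "convex_on {c..b} (\<lambda>x. - f x)" using assms(3) by (simp add: concave_on_def)
    show "continuous_on {c..b} (\<lambda>x. - f x)" using assms(4) by (rule continuous_on_minus)
    fix x assume x: "x \<in> {c..b}"
    show "- f c + - \<delta> * (x - c) \<le> - f x" using assms(5)[OF x] by simp
    show "- f b - - m * (b - x) \<le> - f x" using assms(6)[OF x] by simp
  qed
  then obtain g where "linear_interpolation n (\<lambda>x. - f x) c b g"
    "\<And>x. x \<in> {c..b} \<Longrightarrow> \<bar>- f x - g x\<bar> \<le> (\<delta> - m) * (b - c) / (4 * (real n)\<^sup>2)" by auto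
  then show ?thesis by (rule mean_interpolable_uminus[OF mean_interpolable_uniform[OF prob_space_axioms]])
qed

text \<open>The interval is split at a maximiser \<open>c\<close> of \<open>f x - \<delta> x\<close>, where the slope is \<open>\<delta>\<close>. If \<open>c\<close> is an end
  point then one of the two parts is empty and the other one receives all \<open>2 K\<close> pieces.\<close>

lemma mean_interpolable_concave_mono:
  assumes ab: "a < b" and conc: "concave_on {a..b} f" and cont: "continuous_on {a..b} f"
    and mon: "mono_on {a..b} f"
    and K: "K \<ge> 1" and d: "0 < \<delta>" and m: "m \<le> \<delta>" and z: "0 \<le> z"
    and V: "V = f b - f a"
    and slope_ge: "\<And>x y. a \<le> x \<Longrightarrow> x < y \<Longrightarrow> y \<le> b \<Longrightarrow> m * (y - x) \<le> f y - f x"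
    and slope_le: "\<And>x y. a \<le> x \<Longrightarrow> x < y \<Longrightarrow> y \<le> b \<Longrightarrow> 2 * real K * z * (f y - f x) \<le> V * (y - x)"
    and zV: "z \<le> V / (2 * real K * \<delta>)"
  shows "mean_interpolable Q (2 * K) f a b (V * w 0 + (\<delta> - m) * (b - a) / (4 * (real K)\<^sup>2)
           + V / real K * (Psi w (V / (2 * real K * \<delta>)) - Psi w z))"
proof -
  define N where "N = real K"
  have N: "1 \<le> N" using K by (simp add: N_def)
  \<comment> \<open>The height budget for \<open>K\<close> pieces: the steep side varies by at most
    \<open>V\<close>, wherever the split point lies.\<close>
  define h where "h = V / N"
  have V0: "0 \<le> V" unfolding V using mono_onD[OF mon, of a b] ab by simp
  have h0: "0 \<le> h" using V0 N by (simp add: h_def)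
  have hd: "V / (2 * N * \<delta>) = h / (2 * \<delta>)" by (simp add: h_def)
  define P where "P = Psi w (h / (2 * \<delta>)) - Psi w z"
  have P: "0 \<le> P"
    using Psi_mono[OF w_mono Psi_fin z] zV unfolding P_def N_def[symmetric] hd by simp
  have w0: "0 \<le> w 0" by (rule w_nonneg) simp
  have slope: "2 * z * (f y - f x) \<le> h * (y - x)" if "a \<le> x" "x < y" "y \<le> b" for x y
  proof -
    have "N * (2 * z * (f y - f x)) \<le> N * (h * (y - x))"
      using slope_le[OF that] N unfolding N_def[symmetric] h_def by (simp add: mult_ac)
    then show ?thesis using N by simp
  qed
  have "continuous_on {a..b} (\<lambda>x. f x - \<delta> * x)" by (intro continuous_intros cont)
  then obtain c where c: "c \<in> {a..b}" "\<And>y. y \<in> {a..b} \<Longrightarrow> f y - \<delta> * y \<le> f c - \<delta> * c"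
    using continuous_attains_sup[of "{a..b}" "\<lambda>x. f x - \<delta> * x"] ab by auto
  have steep: "mean_interpolable Q n f a c ((f c - f a) * w 0 + h * P)"
    if ac: "a < c" and n: "n \<ge> 1" "f c - f a \<le> h * real n" for n
    unfolding P_def
  proof (rule mean_interpolable_steep[OF n(1) ac _ _ d _ n(2) z])
    have sub: "{a..c} \<subseteq> {a..b}" using c(1) by auto
    show "concave_on {a..c} f" using conc sub unfolding concave_on_def by (auto intro: convex_on_subset)
    show "continuous_on {a..c} f" using cont sub by (rule continuous_on_subset)
    show "f x \<le> f c - \<delta> * (c - x)" if "x \<in> {a..c}" for x
      using c(2)[of x] c(1) that by (simp add: algebra_simps)
    show "2 * z * (f y - f x) \<le> h * (y - x)" if "a \<le> x" "x < y" "y \<le> c" for x y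
      using slope[of x y] that c(1) by simp
  qed
  have shallow: "mean_interpolable Q n f c b ((\<delta> - m) * (b - c) / (4 * (real n)\<^sup>2))"
    if cb: "c < b" and n: "n \<ge> 1" for n
  proof (rule mean_interpolable_shallow[OF n cb])
    have sub: "{c..b} \<subseteq> {a..b}" using c(1) by auto
    show "concave_on {c..b} f" using conc sub unfolding concave_on_def by (auto intro: convex_on_subset)
    show "continuous_on {c..b} f" using cont sub by (rule continuous_on_subset)
    show "f x \<le> f c + \<delta> * (x - c)" if "x \<in> {c..b}" for x
      using c(2)[of x] c(1) that by (simp add: algebra_simps)
    show "m * (b - x) \<le> f b - f x" if "x \<in> {c..b}" for x
      using slope_ge[of x b] c(1) that by (cases "x = b") auto
  qed
  have fc: "f a \<le> f c" "f c \<le> f b" using c(1) ab by (auto intro!: mono_onD[OF mon])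
  have VN: "V = h * N" using N by (simp add: h_def)
  let ?B = "V * w 0 + (\<delta> - m) * (b - a) / (4 * N\<^sup>2) + h * P"
  have E: "0 \<le> (\<delta> - m) * (b - a) / (4 * N\<^sup>2)" using m ab by simp
  have VB: "0 \<le> V * w 0" "0 \<le> h * P" using V0 h0 w0 P by auto
  consider "a = c" | "c = b" "a < c" | "a < c" "c < b" using c(1) by fastforce
  then have "mean_interpolable Q (2 * K) f a b ?B"
  proof cases
    case 1
    have "mean_interpolable Q (2 * K) f a b ((\<delta> - m) * (b - a) / (4 * (real (2 * K))\<^sup>2))"
      using shallow[of "2 * K"] 1 ab K by simp
    \<comment> \<open>Using all \<open>2 K\<close> pieces on the flat side only improves the error,
      which is weakened here to the common form.\<close>
    moreover have "(\<delta> - m) * (b - a) / (4 * (real (2 * K))\<^sup>2) \<le> (\<delta> - m) * (b - a) / (4 * N\<^sup>2)"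
      using N m ab by (intro divide_left_mono) (auto simp: N_def power_mult_distrib)
    then have "(\<delta> - m) * (b - a) / (4 * (real (2 * K))\<^sup>2) \<le> ?B" using VB by linarith
    ultimately show ?thesis by (rule mean_interpolable_mono)
  next
    case 2
    have "f c - f a \<le> h * real (2 * K)" using 2 V VN V0 by (simp add: N_def)
    then have "mean_interpolable Q (2 * K) f a b ((f b - f a) * w 0 + h * P)"
      using steep[of "2 * K"] 2 K by simp
    moreover have "(f b - f a) * w 0 + h * P \<le> ?B" using E V by simp
    ultimately show ?thesis by (rule mean_interpolable_mono)
  next
    case 3
    have "f c - f a \<le> h * real K" using fc V VN by (simp add: N_def)
    then have s: "mean_interpolable Q K f a c ((f c - f a) * w 0 + h * P)" using steep 3 K by simp
    have "mean_interpolable Q (K + K) f a b ((f c - f a) * w 0 + h * P + (\<delta> - m) * (b - c) / (4 * (real K)\<^sup>2))"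
      by (rule mean_interpolable_append[OF sets_Q s shallow]) (use 3 K fc w0 VB m in auto)
    moreover have "(f c - f a) * w 0 \<le> V * w 0" unfolding V using fc w0 by (intro mult_right_mono) auto
    moreover have "(\<delta> - m) * (b - c) / (4 * (real K)\<^sup>2) \<le> (\<delta> - m) * (b - a) / (4 * N\<^sup>2)"
      unfolding N_def using 3 m by (intro divide_right_mono mult_left_mono) auto
    ultimately show ?thesis by (auto simp: mult_2 intro: mean_interpolable_mono)
  qed
  then show ?thesis unfolding P_def N_def[symmetric] hd h_def[symmetric] .
qed

end

section \<open>End slopes and symmetries\<close>

lemma tendsto_at_right_INF:
  fixes \<phi> :: "real \<Rightarrow> ereal"
  assumes ab: "a < b" and mono: "\<And>x y. a < x \<Longrightarrow> x \<le> y \<Longrightarrow> y \<le> b \<Longrightarrow> \<phi> x \<le> \<phi> y"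
  shows "(\<phi> \<longlongrightarrow> (INF y\<in>{a<..b}. \<phi> y)) (at_right a)"
proof (rule order_tendstoI)
  fix l assume l: "l < (INF y\<in>{a<..b}. \<phi> y)"
  show "\<forall>\<^sub>F y in at_right a. l < \<phi> y"
    unfolding eventually_at_right_field
    by (rule exI[of _ b]) (use ab in \<open>auto intro!: less_le_trans[OF l] INF_lower\<close>)
next
  fix u assume "(INF y\<in>{a<..b}. \<phi> y) < u"
  then obtain y where y: "y \<in> {a<..b}" "\<phi> y < u" by (auto simp: INF_less_iff)
  have "\<phi> x < u" if "a < x" "x < y" for x
    using le_less_trans[OF mono[of x y] y(2)] that y(1) by simp
  then show "\<forall>\<^sub>F x in at_right a. \<phi> x < u"
    unfolding eventually_at_right_field using y by (intro exI[of _ y]) auto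
qed

lemma tendsto_at_left_SUP:
  fixes \<phi> :: "real \<Rightarrow> ereal"
  assumes ab: "a < b" and mono: "\<And>x y. a \<le> x \<Longrightarrow> x \<le> y \<Longrightarrow> y < b \<Longrightarrow> \<phi> x \<le> \<phi> y"
  shows "(\<phi> \<longlongrightarrow> (SUP y\<in>{a..<b}. \<phi> y)) (at_left b)"
proof (rule order_tendstoI)
  fix u assume u: "(SUP y\<in>{a..<b}. \<phi> y) < u"
  show "\<forall>\<^sub>F y in at_left b. \<phi> y < u"
    unfolding eventually_at_left_field
    by (rule exI[of _ a]) (use ab in \<open>auto intro!: le_less_trans[OF _ u] SUP_upper\<close>)
next
  fix l assume "l < (SUP y\<in>{a..<b}. \<phi> y)"
  then obtain y where y: "y \<in> {a..<b}" "l < \<phi> y" by (auto simp: less_SUP_iff)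
  have "l < \<phi> x" if "y < x" "x < b" for x
    using less_le_trans[OF y(2) mono[of y x]] that y(1) by simp
  then show "\<forall>\<^sub>F x in at_left b. l < \<phi> x"
    unfolding eventually_at_left_field using y by (intro exI[of _ y]) auto
qed

text \<open>The passage from the chord over [x, y] to the one over [u, v] goes through the chord
  over [x, v], moving one end point at a time.\<close>

lemma convex_slope_mono:
  fixes f :: "real \<Rightarrow> real"
  assumes f: "convex_on S f" and S: "x \<in> S" "y \<in> S" "u \<in> S" "v \<in> S"
    and le: "x < y" "u < v" "x \<le> u" "y \<le> v"
  shows "(f y - f x) / (y - x) \<le> (f v - f u) / (v - u)"
proof -
  have "(f y - f x) / (y - x) \<le> (f v - f x) / (v - x)"
  proof (cases "y = v")
    case False
    have "f y * (v - x) \<le> f x * (v - y) + f v * (y - x)"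
      using convex_on_three_points[OF f S(1,4), of y] le by simp
    then have "(f y - f x) * (v - x) \<le> (f v - f x) * (y - x)" by (simp add: algebra_simps)
    then show ?thesis using le by (simp add: frac_le_eq divide_simps mult.commute)
  qed simp
  also have "\<dots> \<le> (f v - f u) / (v - u)"
  proof (cases "x = u")
    case False
    have "f u * (v - x) \<le> f x * (v - u) + f v * (u - x)"
      using convex_on_three_points[OF f S(1,4), of u] le by simp
    then have "(f v - f x) * (v - u) \<le> (f v - f u) * (v - x)" by (simp add: algebra_simps)
    then show ?thesis using le by (simp add: divide_simps mult.commute)
  qed simp
  finally show ?thesis .
qed

lemma slope_commute:
  fixes f :: "real \<Rightarrow> real"
  shows "(f x - f y) / (x - y) = (f y - f x) / (y - x)"
  using minus_divide_divide[of "f x - f y" "x - y"] by simp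

text \<open>Difference quotients of a convex function are monotone in the moving end point, so they
  converge in the extended reals. The \<open>Lim\<close> in the definitions is therefore a genuine
  limit and equals an infimum or a supremum.\<close>

lemma convex_end_derivatives:
  fixes f :: "real \<Rightarrow> real"
  assumes ab: "a < b" and f: "convex_on {a..b} f"
  defines "sl \<equiv> (\<lambda>x y. ereal ((f y - f x) / (y - x)))"
  shows "(sl a \<longlongrightarrow> (INF y\<in>{a<..b}. sl a y)) (at_right a)"
    and "((\<lambda>y. sl y b) \<longlongrightarrow> (SUP y\<in>{a..<b}. sl y b)) (at_left b)"
    and "right_derivative f a = (INF y\<in>{a<..b}. sl a y)"
    and "left_derivative f b = (SUP y\<in>{a..<b}. sl y b)"
proof -
  show R: "(sl a \<longlongrightarrow> (INF y\<in>{a<..b}. sl a y)) (at_right a)"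
    unfolding sl_def
    by (rule tendsto_at_right_INF[OF ab], subst ereal_less_eq(3),
        rule convex_slope_mono[OF f]) auto
  show L: "((\<lambda>y. sl y b) \<longlongrightarrow> (SUP y\<in>{a..<b}. sl y b)) (at_left b)"
    unfolding sl_def
    by (rule tendsto_at_left_SUP[OF ab], subst ereal_less_eq(3),
        rule convex_slope_mono[OF f]) auto
  show "right_derivative f a = (INF y\<in>{a<..b}. sl a y)"
    unfolding right_derivative_def using tendsto_Lim[OF _ R] by (simp add: sl_def)
  have "(\<lambda>y. ereal ((f y - f b) / (y - b))) = (\<lambda>y. sl y b)"
    unfolding sl_def by (simp only: slope_commute[of f b])
  then show "left_derivative f b = (SUP y\<in>{a..<b}. sl y b)"
    unfolding left_derivative_def using tendsto_Lim[OF _ L] by simp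
qed

text \<open>A change of sign passes through \<open>Lim\<close> because the limits are known to exist
  by convexity; this transfers the end slopes to concave functions.\<close>

lemma convex_end_derivatives_uminus:
  fixes f :: "real \<Rightarrow> real"
  assumes ab: "a < b" and f: "convex_on {a..b} f"
  shows "right_derivative (\<lambda>x. - f x) a = - right_derivative f a"
    and "left_derivative (\<lambda>x. - f x) b = - left_derivative f b"
proof -
  note e = convex_end_derivatives[OF ab f]
  have *: "- ereal ((f y - f x) / (y - x)) = ereal ((- f y - - f x) / (y - x))" for x y
    by (simp add: minus_divide_left)
  show "right_derivative (\<lambda>x. - f x) a = - right_derivative f a"
    using tendsto_Lim[OF _ tendsto_uminus_ereal[OF e(1)]]
    unfolding * e(3) by (simp add: right_derivative_def)
  have **: "- ereal ((f b - f y) / (b - y)) = ereal ((- f y - - f b) / (y - b))" for y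
    unfolding * slope_commute[of "\<lambda>x. - f x" b y] ..
  show "left_derivative (\<lambda>x. - f x) b = - left_derivative f b"
    using tendsto_Lim[OF _ tendsto_uminus_ereal[OF e(2)]]
    unfolding ** e(4) by (simp add: left_derivative_def)
qed

lemma convex_slope_between_derivatives:
  fixes f :: "real \<Rightarrow> real"
  assumes f: "convex_on {a..b} f" and xy: "a \<le> x" "x < y" "y \<le> b"
  shows "right_derivative f a \<le> ereal ((f y - f x) / (y - x))"
    and "ereal ((f y - f x) / (y - x)) \<le> left_derivative f b"
proof -
  have ab: "a < b" using xy by simp
  have "right_derivative f a \<le> ereal ((f y - f a) / (y - a))"
    unfolding convex_end_derivatives(3)[OF ab f] using xy by (intro INF_lower) auto
  also have "\<dots> \<le> ereal ((f y - f x) / (y - x))"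
    using convex_slope_mono[OF f, of a y x y] xy by simp
  finally show "right_derivative f a \<le> ereal ((f y - f x) / (y - x))" .
  have "ereal ((f y - f x) / (y - x)) \<le> ereal ((f b - f x) / (b - x))"
    using convex_slope_mono[OF f, of x y x b] xy by simp
  also have "\<dots> \<le> left_derivative f b"
    unfolding convex_end_derivatives(4)[OF ab f] using xy by (intro SUP_upper) auto
  finally show "ereal ((f y - f x) / (y - x)) \<le> left_derivative f b" .
qed

text \<open>Replaces the extended derivatives by a real \<open>m\<close> and a possibly infinite
  \<open>M\<close> that enclose all absolute chord slopes. The smaller one is finite because the
  chord over \<open>{a..b}\<close> bounds it. It is attained at \<open>a\<close> if \<open>f\<close>
  increases and at \<open>b\<close> if \<open>f\<close> decreases.\<close>

lemma end_slopes_convex: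
  fixes f :: "real \<Rightarrow> real"
  assumes ab: "a < b" and f: "convex_on {a..b} f"
    and mon: "mono_on {a..b} f \<or> antimono_on {a..b} f"
  shows "\<exists>m M. 0 \<le> m \<and> min_end_slope f a b = ereal m \<and> max_end_slope f a b = M \<and>
      \<bar>right_derivative f a - left_derivative f b\<bar> = M - ereal m \<and>
      (\<forall>x y. a \<le> x \<longrightarrow> x < y \<longrightarrow> y \<le> b \<longrightarrow>
         ereal m \<le> ereal (\<bar>f y - f x\<bar> / (y - x)) \<and> ereal (\<bar>f y - f x\<bar> / (y - x)) \<le> M)"
proof -
  define R where "R = right_derivative f a"
  define L where "L = left_derivative f b"
  have sl: "R \<le> ereal ((f y - f x) / (y - x))" "ereal ((f y - f x) / (y - x)) \<le> L"
    if "a \<le> x" "x < y" "y \<le> b" for x y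
    unfolding R_def L_def using convex_slope_between_derivatives[OF f that] by auto
  define s where "s = (f b - f a) / (b - a)"
  have s: "R \<le> ereal s" "ereal s \<le> L" using sl[of a b] ab by (auto simp: s_def)
  from mon show ?thesis
  proof
    assume mon: "mono_on {a..b} f"
    have ab_eq: "\<bar>f y - f x\<bar> = f y - f x" if "a \<le> x" "x < y" "y \<le> b" for x y
      using mono_onD[OF mon, of x y] that by simp
    have "0 \<le> R" unfolding R_def convex_end_derivatives(3)[OF ab f]
      by (rule INF_greatest) (auto intro!: divide_nonneg_nonneg mono_onD[OF mon])
    with s obtain m where m: "R = ereal m" "0 \<le> m" by (cases R) auto
    have "R \<le> L" "0 \<le> L" using s \<open>0 \<le> R\<close> by auto
    then have "\<bar>R\<bar> = R" "\<bar>L\<bar> = L" "min R L = R" "max R L = L" "\<bar>R - L\<bar> = L - R"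
      using m by (auto simp: min_def max_def) (cases L; simp)
    then show ?thesis
      unfolding min_end_slope_def max_end_slope_def R_def[symmetric] L_def[symmetric]
      using m sl by (intro exI[of _ m] exI[of _ L]) (auto simp: ab_eq)
  next
    assume mon: "antimono_on {a..b} f"
    have ab_eq: "\<bar>f y - f x\<bar> / (y - x) = - ((f y - f x) / (y - x))" if "a \<le> x" "x < y" "y \<le> b" for x y
      using monotone_onD[OF mon, of x y] that by (simp add: minus_divide_left)
    have "L \<le> 0" unfolding L_def convex_end_derivatives(4)[OF ab f]
      by (rule SUP_least) (auto intro!: divide_nonpos_nonneg monotone_onD[OF mon])
    with s obtain m where m: "L = ereal (- m)" "0 \<le> m"
    proof (cases L)
      case (real r)
      then show ?thesis using \<open>L \<le> 0\<close> by (intro that[of "- r"]) auto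
    qed auto
    have "R \<le> L" "R \<le> 0" using s \<open>L \<le> 0\<close> by auto
    then have "\<bar>R\<bar> = - R" "\<bar>L\<bar> = ereal m" "min (- R) (ereal m) = ereal m"
      "max (- R) (ereal m) = - R" "\<bar>R - L\<bar> = - R - ereal m"
      using m by (cases R; auto simp: min_def max_def)+
    moreover have "ereal m \<le> - ereal ((f y - f x) / (y - x))" "- ereal ((f y - f x) / (y - x)) \<le> - R"
      if "a \<le> x" "x < y" "y \<le> b" for x y
      using sl[OF that] m(1) by (auto simp: ereal_minus_le_minus) (simp flip: uminus_ereal.simps)
    ultimately show ?thesis
      unfolding min_end_slope_def max_end_slope_def R_def[symmetric] L_def[symmetric]
      using m by (intro exI[of _ m] exI[of _ "- R"]) (auto simp: ab_eq)
  qed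
qed

lemma end_slopes:
  fixes f :: "real \<Rightarrow> real"
  assumes ab: "a < b" and f: "convex_concave_on {a..b} f"
    and mon: "mono_on {a..b} f \<or> antimono_on {a..b} f"
  shows "\<exists>m M. 0 \<le> m \<and> min_end_slope f a b = ereal m \<and> max_end_slope f a b = M \<and>
      \<bar>right_derivative f a - left_derivative f b\<bar> = M - ereal m \<and>
      (\<forall>x y. a \<le> x \<longrightarrow> x < y \<longrightarrow> y \<le> b \<longrightarrow>
         ereal m \<le> ereal (\<bar>f y - f x\<bar> / (y - x)) \<and> ereal (\<bar>f y - f x\<bar> / (y - x)) \<le> M)"
proof (cases "convex_on {a..b} f")
  case True
  then show ?thesis using end_slopes_convex[OF ab _ mon] by blast
next
  case False
  then have c: "convex_on {a..b} (\<lambda>x. - f x)" using f by (simp add: convex_concave_on_def concave_on_def)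
  have mon': "mono_on {a..b} (\<lambda>x. - f x) \<or> antimono_on {a..b} (\<lambda>x. - f x)"
    using mon by (auto simp: monotone_on_def)
  have r: "right_derivative f a = - right_derivative (\<lambda>x. - f x) a"
    and l: "left_derivative f b = - left_derivative (\<lambda>x. - f x) b"
    using convex_end_derivatives_uminus[OF ab c] by simp_all
  have "\<bar>- x - - y\<bar> = \<bar>x - y\<bar>" for x y :: ereal by (cases x; cases y) auto
  moreover have "\<bar>- f y - - f x\<bar> = \<bar>f y - f x\<bar>" for x y by linarith
  ultimately show ?thesis
    using end_slopes_convex[OF ab c mon'] unfolding min_end_slope_def max_end_slope_def r l by simp
qed

text \<open>The signed slopes of a convex function lie in [m, M] if it increases and in [-M, -m] if
  it decreases. Both ranges have length M - m, the only quantity in the bound; the concave case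
  follows by a change of sign.\<close>

lemma convex_concave_interpolation_uniform:
  fixes f :: "real \<Rightarrow> real"
  assumes n: "n \<ge> 1" and ab: "a < b" and f: "convex_concave_on {a..b} f"
    and cont: "continuous_on {a..b} f"
    and mon: "mono_on {a..b} f \<or> antimono_on {a..b} f"
    and m: "\<And>x y. a \<le> x \<Longrightarrow> x < y \<Longrightarrow> y \<le> b \<Longrightarrow> m * (y - x) \<le> \<bar>f y - f x\<bar>"
    and M: "\<And>x y. a \<le> x \<Longrightarrow> x < y \<Longrightarrow> y \<le> b \<Longrightarrow> \<bar>f y - f x\<bar> \<le> M * (y - x)"
  shows "\<exists>g. linear_interpolation n f a b g \<and>
           (\<forall>x\<in>{a..b}. \<bar>f x - g x\<bar> \<le> (M - m) * (b - a) / (4 * (real n)\<^sup>2))"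
proof -
  have conv: "\<exists>g. linear_interpolation n h a b g \<and>
           (\<forall>x\<in>{a..b}. \<bar>h x - g x\<bar> \<le> (M - m) * (b - a) / (4 * (real n)\<^sup>2))"
    if h: "convex_on {a..b} h" "continuous_on {a..b} h" "mono_on {a..b} h \<or> antimono_on {a..b} h"
      and hf: "\<And>x y. \<bar>h y - h x\<bar> = \<bar>f y - f x\<bar>" for h
  proof -
    have m': "m * (y - x) \<le> \<bar>h y - h x\<bar>" and M': "\<bar>h y - h x\<bar> \<le> M * (y - x)"
      if "a \<le> x" "x \<le> y" "y \<le> b" for x y
      using m[of x y] M[of x y] that unfolding hf by (cases "x = y"; simp)+
    from h(3) show ?thesis
    proof
      assume mon: "mono_on {a..b} h"
      have e: "\<bar>h y - h x\<bar> = h y - h x" if "a \<le> x" "x \<le> y" "y \<le> b" for x y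
        using mono_onD[OF mon, of x y] that by simp
      show ?thesis
      proof (rule convex_interpolation_uniform[OF n ab h(1,2)])
        fix x assume x: "x \<in> {a..b}"
        show "h a + m * (x - a) \<le> h x" using m'[of a x] e[of a x] x by simp
        show "h b - M * (b - x) \<le> h x" using M'[of x b] e[of x b] x by simp
      qed
    next
      assume mon: "antimono_on {a..b} h"
      have e: "\<bar>h y - h x\<bar> = h x - h y" if "a \<le> x" "x \<le> y" "y \<le> b" for x y
        using monotone_onD[OF mon, of x y] that by simp
      have "\<exists>g. linear_interpolation n h a b g \<and>
           (\<forall>x\<in>{a..b}. \<bar>h x - g x\<bar> \<le> (- m - - M) * (b - a) / (4 * (real n)\<^sup>2))"
      proof (rule convex_interpolation_uniform[OF n ab h(1,2)])
        fix x assume x: "x \<in> {a..b}"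
        show "h a + - M * (x - a) \<le> h x" using M'[of a x] e[of a x] x by simp
        show "h b - - m * (b - x) \<le> h x" using m'[of x b] e[of x b] x by simp
      qed
      then show ?thesis by simp
    qed
  qed
  show ?thesis
  proof (cases "convex_on {a..b} f")
    case True
    then show ?thesis using conv[of f] cont mon by blast
  next
    case False
    have "\<exists>g. linear_interpolation n (\<lambda>x. - f x) a b g \<and>
           (\<forall>x\<in>{a..b}. \<bar>- f x - g x\<bar> \<le> (M - m) * (b - a) / (4 * (real n)\<^sup>2))"
    proof (rule conv)
      show "convex_on {a..b} (\<lambda>x. - f x)" using f False by (simp add: convex_concave_on_def concave_on_def)
      show "continuous_on {a..b} (\<lambda>x. - f x)" using cont by (rule continuous_on_minus)
      show "mono_on {a..b} (\<lambda>x. - f x) \<or> antimono_on {a..b} (\<lambda>x. - f x)"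
        using mon by (auto simp: monotone_on_def)
    qed linarith
    then obtain g where g: "linear_interpolation n (\<lambda>x. - f x) a b g"
      "\<And>x. x \<in> {a..b} \<Longrightarrow> \<bar>- f x - g x\<bar> \<le> (M - m) * (b - a) / (4 * (real n)\<^sup>2)" by blast
    have "linear_interpolation n f a b (\<lambda>x. - g x)" using linear_interpolation_uminus[OF g(1)] by simp
    moreover have "\<bar>f x - - g x\<bar> = \<bar>- f x - g x\<bar>" for x by linarith
    ultimately show ?thesis using g(2) by (intro exI[of _ "\<lambda>x. - g x"]) simp
  qed
qed

section \<open>Reduction to concave nondecreasing functions\<close>

lemma concave_on_reflect:
  assumes "concave_on {a..b} (f :: real \<Rightarrow> real)"
  shows "concave_on {a..b} (\<lambda>x. f (a + b - x))"
  unfolding concave_on_iff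
proof (intro conjI ballI allI impI)
  fix x y u v :: real
  assume *: "x \<in> {a..b}" "y \<in> {a..b}" "0 \<le> u" "0 \<le> v" "u + v = 1"
  have v: "v = 1 - u" using * by simp
  have "a + b - (u *\<^sub>R x + v *\<^sub>R y) = u *\<^sub>R (a + b - x) + v *\<^sub>R (a + b - y)"
    unfolding v by (simp add: algebra_simps)
  moreover have "u * f (a + b - x) + v * f (a + b - y) \<le> f (u *\<^sub>R (a + b - x) + v *\<^sub>R (a + b - y))"
    using assms * unfolding concave_on_iff by simp
  ultimately show "u * f (a + b - x) + v * f (a + b - y) \<le> f (a + b - (u *\<^sub>R x + v *\<^sub>R y))" by simp
qed simp

context measure_modulus
begin

text \<open>A decreasing concave function is reflected, not negated: this keeps concavity and
  reverses monotonicity. The slope hypotheses are stated with absolute values so that they carry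
  over unchanged.\<close>

lemma mean_interpolable_concave:
  assumes ab: "a < b" and conc: "concave_on {a..b} f" and cont: "continuous_on {a..b} f"
    and mon: "mono_on {a..b} f \<or> antimono_on {a..b} f"
    and K: "K \<ge> 1" and d: "0 < \<delta>" and m: "m \<le> \<delta>" and z: "0 \<le> z"
    and V: "V = \<bar>f b - f a\<bar>"
    and slope_ge: "\<And>x y. a \<le> x \<Longrightarrow> x < y \<Longrightarrow> y \<le> b \<Longrightarrow> m * (y - x) \<le> \<bar>f y - f x\<bar>"
    and slope_le: "\<And>x y. a \<le> x \<Longrightarrow> x < y \<Longrightarrow> y \<le> b \<Longrightarrow> 2 * real K * z * \<bar>f y - f x\<bar> \<le> V * (y - x)"
    and zV: "z \<le> V / (2 * real K * \<delta>)"
  shows "mean_interpolable Q (2 * K) f a b (V * w 0 + (\<delta> - m) * (b - a) / (4 * (real K)\<^sup>2)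
           + V / real K * (Psi w (V / (2 * real K * \<delta>)) - Psi w z))"
  using mon
proof
  assume mon: "mono_on {a..b} f"
  have e: "\<bar>f y - f x\<bar> = f y - f x" if "a \<le> x" "x \<le> y" "y \<le> b" for x y
    using mono_onD[OF mon, of x y] that by simp
  show ?thesis
    by (rule mean_interpolable_concave_mono[OF ab conc cont mon K d m z _ _ _ zV])
      (use slope_ge slope_le V e ab in \<open>simp_all\<close>)
next
  assume anti: "antimono_on {a..b} f"
  let ?h = "\<lambda>x. f (a + b - x)"
  interpret R: measure_modulus "distr Q borel (\<lambda>x. a + b - x)" w by (rule measure_modulus_reflect)
  have e: "\<bar>f y - f x\<bar> = f x - f y" if "a \<le> x" "x \<le> y" "y \<le> b" for x y
    using monotone_onD[OF anti, of x y] that by simp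
  show ?thesis
  proof (rule mean_interpolable_reflect[OF sets_Q],
      rule R.mean_interpolable_concave_mono[OF ab concave_on_reflect[OF conc] _ _ K d m z _ _ _ zV])
    show "continuous_on {a..b} ?h"
      by (rule continuous_on_compose2[OF cont]) (auto intro!: continuous_intros)
    show "mono_on {a..b} ?h"
      by (rule mono_onI) (use monotone_onD[OF anti] in auto)
    show "V = ?h b - ?h a" using V e[of a b] ab by simp
    show "m * (y - x) \<le> ?h y - ?h x" if "a \<le> x" "x < y" "y \<le> b" for x y
      using slope_ge[of "a + b - y" "a + b - x"] e[of "a + b - y" "a + b - x"] that by simp
    show "2 * real K * z * (?h y - ?h x) \<le> V * (y - x)" if "a \<le> x" "x < y" "y \<le> b" for x y
      using slope_le[of "a + b - y" "a + b - x"] e[of "a + b - y" "a + b - x"] that by simp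
  qed
qed

lemma convex_concave_interpolation_integral_le:
  assumes ab: "a < b" and f: "convex_concave_on {a..b} f" and cont: "continuous_on {a..b} f"
    and mon: "mono_on {a..b} f \<or> antimono_on {a..b} f"
    and K: "K \<ge> 1" and d: "0 < \<delta>" and m: "m \<le> \<delta>" and z: "0 \<le> z"
    and V: "V = \<bar>f b - f a\<bar>"
    and slope_ge: "\<And>x y. a \<le> x \<Longrightarrow> x < y \<Longrightarrow> y \<le> b \<Longrightarrow> m * (y - x) \<le> \<bar>f y - f x\<bar>"
    and slope_le: "\<And>x y. a \<le> x \<Longrightarrow> x < y \<Longrightarrow> y \<le> b \<Longrightarrow> 2 * real K * z * \<bar>f y - f x\<bar> \<le> V * (y - x)"
    and zV: "z \<le> V / (2 * real K * \<delta>)"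
  shows "\<exists>g. linear_interpolation (2 * K) f a b g \<and>
     (LINT x:{a..b}|Q. \<bar>f x - g x\<bar>) \<le> V * w 0 + (\<delta> - m) * (b - a) / (4 * (real K)\<^sup>2)
           + V / real K * (Psi w (V / (2 * real K * \<delta>)) - Psi w z)"
proof (rule mean_interpolable_integral_le)
  let ?B = "V * w 0 + (\<delta> - m) * (b - a) / (4 * (real K)\<^sup>2)
           + V / real K * (Psi w (V / (2 * real K * \<delta>)) - Psi w z)"
  have "0 \<le> V * w 0" using w_nonneg[of 0] V by simp
  moreover have "0 \<le> (\<delta> - m) * (b - a) / (4 * (real K)\<^sup>2)" using m ab by simp
  moreover have "0 \<le> V / real K * (Psi w (V / (2 * real K * \<delta>)) - Psi w z)"
    using Psi_mono[OF w_mono Psi_fin z zV] V by simp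
  ultimately show "0 \<le> ?B" by linarith
  show "mean_interpolable Q (2 * K) f a b ?B"
  proof (cases "concave_on {a..b} f")
    case True
    then show ?thesis
      by (rule mean_interpolable_concave[OF ab _ cont mon K d m z V slope_ge slope_le zV])
  next
    case False
    have e: "\<bar>- f y - - f x\<bar> = \<bar>f y - f x\<bar>" for x y by linarith
    show ?thesis
    proof (rule mean_interpolable_uminus,
        rule mean_interpolable_concave[OF ab _ _ _ K d m z _ _ _ zV])
      show "concave_on {a..b} (\<lambda>x. - f x)" using f False by (simp add: convex_concave_on_def concave_on_def)
      show "continuous_on {a..b} (\<lambda>x. - f x)" using cont by (rule continuous_on_minus)
      show "mono_on {a..b} (\<lambda>x. - f x) \<or> antimono_on {a..b} (\<lambda>x. - f x)"
        using mon by (auto simp: monotone_on_def)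
    qed (use V slope_ge slope_le in \<open>simp_all only: e\<close>)
  qed
qed

end

lemma measure_modulusI:
  assumes "real_distribution Q" "is_modulus Q w" "Psi_finite w"
  shows "measure_modulus Q w"
proof -
  interpret real_distribution Q by fact
  have "emeasure Q {u..v} \<le> ennreal (w (v - u))" if "u \<le> v" for u v
    using assms(2) that unfolding is_modulus_def
    by (metis bounded_closed_interval is_interval_cc measure_lborel_Icc)
  then show ?thesis
    using assms(2,3) prob_space_axioms events_eq_borel
    by (simp add: measure_modulus_def measure_modulus_axioms_def is_modulus_def)
qed

text \<open>The third property is the form in which the steep estimate uses \<open>z\<close>: it
  makes sense for an infinite \<open>M\<close> as well, where the quotient is 0 and the inequality
  reduces to 0 \<le> V.\<close>

lemma real_of_ereal_slope_quotient:
  assumes "0 \<le> V" "0 < N" "0 < \<delta>" "ereal \<delta> \<le> M"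
  defines "z \<equiv> real_of_ereal (ereal V / (ereal (2 * N) * M))"
  shows "0 \<le> z" "z \<le> V / (2 * N * \<delta>)" "\<And>s. ereal s \<le> M \<Longrightarrow> 2 * N * z * s \<le> V"
proof -
  have "M = \<infinity> \<or> (\<exists>r. M = ereal r \<and> \<delta> \<le> r)" using assms(4) by (cases M) auto
  then consider "M = \<infinity>" | r where "M = ereal r" "\<delta> \<le> r" by blast
  then have "0 \<le> z \<and> z \<le> V / (2 * N * \<delta>) \<and> (\<forall>s. ereal s \<le> M \<longrightarrow> 2 * N * z * s \<le> V)"
  proof cases
    case 1
    then have "z = 0" using assms by (simp add: z_def)
    then show ?thesis using assms by simp
  next
    case (2 r)
    then have r: "0 < r" and z: "z = V / (2 * N * r)" using assms by (auto simp: z_def)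
    have "V / (2 * N * r) \<le> V / (2 * N * \<delta>)" using 2 assms r by (intro divide_left_mono) auto
    moreover have "2 * N * z * s \<le> V" if "s \<le> r" for s
    proof -
      have "2 * N * z * s = V * (s / r)" using assms(2) by (simp add: z)
      also have "\<dots> \<le> V * 1" using that r assms(1) by (intro mult_left_mono) auto
      finally show ?thesis by simp
    qed
    ultimately show ?thesis using assms r 2(1) by (simp add: z)
  qed
  then show "0 \<le> z" "z \<le> V / (2 * N * \<delta>)" "\<And>s. ereal s \<le> M \<Longrightarrow> 2 * N * z * s \<le> V" by auto
qed

lemma Psi_powr:
  assumes c: "0 \<le> c" and \<alpha>: "0 < \<alpha>" and w: "\<And>u. 0 \<le> u \<Longrightarrow> w u = w 0 + c * u powr \<alpha>"
  shows "Psi_finite w" and "0 \<le> x \<Longrightarrow> Psi w x = c / \<alpha> * x powr \<alpha>"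
proof -
  have int: "has_bochner_integral lborel (\<lambda>t. indicator {0<..x} t *\<^sub>R modulus_integrand w t) (c / \<alpha> * x powr \<alpha>)"
    if x: "0 \<le> x" for x
  proof -
    have "((\<lambda>t. t powr (\<alpha> - 1)) has_integral (x powr \<alpha> / \<alpha>)) {0..x}"
      using has_integral_powr_from_0[of "\<alpha> - 1" x] \<alpha> x by simp
    then have "((\<lambda>t. if t \<in> {0..x} then t powr (\<alpha> - 1) else 0) has_integral (x powr \<alpha> / \<alpha>)) UNIV"
      by (subst has_integral_restrict_UNIV)
    \<comment> \<open>The end point 0 makes no difference since \<open>0 powr y\<close> is
      0.\<close>
    also have "(\<lambda>t. if t \<in> {0..x} then t powr (\<alpha> - 1) else 0) = (\<lambda>t. indicator {0<..x} t * t powr (\<alpha> - 1))"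
      by (auto simp: indicator_def fun_eq_iff)
    finally have "integral\<^sup>N lborel (\<lambda>t. ennreal (indicator {0<..x} t * t powr (\<alpha> - 1))) = ennreal (x powr \<alpha> / \<alpha>)"
      by (intro nn_integral_has_integral_lborel) auto
    then have "has_bochner_integral lborel (\<lambda>t. indicator {0<..x} t * t powr (\<alpha> - 1)) (x powr \<alpha> / \<alpha>)"
      using \<alpha> by (intro has_bochner_integral_nn_integral) auto
    from has_bochner_integral_mult_right[OF this, of c]
    have "has_bochner_integral lborel (\<lambda>t. c * (indicator {0<..x} t * t powr (\<alpha> - 1))) (c / \<alpha> * x powr \<alpha>)"
      by simp
    moreover have "c * (indicator {0<..x} t * t powr (\<alpha> - 1)) = indicator {0<..x} t *\<^sub>R modulus_integrand w t" for t
      using w[of t] by (auto simp: indicator_def modulus_integrand_def powr_diff)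
    ultimately show ?thesis by simp
  qed
  show "Psi_finite w"
    unfolding Psi_finite_def set_integrable_def
    using int[THEN has_bochner_integral_iff[THEN iffD1]] by simp
  show "0 \<le> x \<Longrightarrow> Psi w x = c / \<alpha> * x powr \<alpha>"
    unfolding Psi_def set_lebesgue_integral_def by (rule has_bochner_integral_integral_eq[OF int])
qed

section \<open>Power moduli\<close>

text \<open>Here \<open>E\<close> is the target error relative to \<open>V\<close>, and r = 2 N^2 E
  satisfies r^(1 + \<alpha>) = 4 A N^(1 - \<alpha>) / \<alpha>. The first claim makes r times the
  mean slope an admissible lower-bounded choice of \<delta>; the second limits the
  \<open>Psi\<close> term to V E / 2, the same share as the flat side.\<close>

lemma powr_balance:
  fixes N A \<alpha> :: real
  assumes A: "1 \<le> A" and \<alpha>: "0 < \<alpha>" "\<alpha> \<le> 1" and N: "1 \<le> N"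
  defines "E \<equiv> (2 powr (1 - \<alpha>) * A / (\<alpha> * N powr (1 + 3 * \<alpha>))) powr (1 / (1 + \<alpha>))"
  shows "1 \<le> 2 * N\<^sup>2 * E" and "A / (\<alpha> * N) \<le> E / 2 * (2 * N * (2 * N\<^sup>2 * E)) powr \<alpha>"
proof -
  define r where "r = 2 * N\<^sup>2 * E"
  have E0: "0 < E" unfolding E_def using A \<alpha> N by simp
  then have r0: "0 < r" using N by (simp add: r_def)
  have "N\<^sup>2 = N powr 2" using N by simp
  then have N2: "N\<^sup>2 powr (1 + \<alpha>) = N powr (2 * (1 + \<alpha>))" by (simp only: powr_powr)
  have "E powr (1 + \<alpha>) = 2 powr (1 - \<alpha>) * A / (\<alpha> * N powr (1 + 3 * \<alpha>))"
    unfolding E_def powr_powr using A \<alpha> N by simp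
  moreover have "r powr (1 + \<alpha>) = 2 powr (1 + \<alpha>) * N powr (2 * (1 + \<alpha>)) * E powr (1 + \<alpha>)"
    unfolding r_def N2[symmetric] using E0 by (simp add: powr_mult)
  moreover have "N powr (2 * (1 + \<alpha>)) = N powr (1 - \<alpha>) * N powr (1 + 3 * \<alpha>)"
    by (simp flip: powr_add)
  moreover have "2 powr (1 + \<alpha>) * 2 powr (1 - \<alpha>) = (4 :: real)"
    by (simp flip: powr_add)
  moreover have "N powr (1 + 3 * \<alpha>) \<noteq> 0" using N by simp
  ultimately have rp: "r powr (1 + \<alpha>) = 4 * A * N powr (1 - \<alpha>) / \<alpha>"
    by simp
  show "1 \<le> 2 * N\<^sup>2 * E"
  proof (rule ccontr)
    assume "\<not> ?thesis"
    then have "r powr (1 + \<alpha>) < 1 powr (1 + \<alpha>)"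
      using r0 \<alpha> by (intro powr_less_mono2) (auto simp: r_def)
    moreover have "1 * 1 \<le> A * N powr (1 - \<alpha>)"
      using A N \<alpha> by (intro mult_mono ge_one_powr_ge_zero) auto
    then have "1 \<le> 4 * A * N powr (1 - \<alpha>) / \<alpha>"
      using \<alpha> by (simp add: pos_le_divide_eq)
    ultimately show False unfolding rp by simp
  qed
  have NN: "N powr (1 - \<alpha>) * N powr \<alpha> = N" using N by (simp flip: powr_add)
  have "E / 2 = r / (4 * N\<^sup>2)" using N by (simp add: r_def)
  then have "E / 2 * (N powr \<alpha> * r powr \<alpha>) = r powr (1 + \<alpha>) * N powr \<alpha> / (4 * N\<^sup>2)"
    using r0 by (simp add: powr_add)
  also have "\<dots> = A * (N powr (1 - \<alpha>) * N powr \<alpha>) / (\<alpha> * N\<^sup>2)"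
    unfolding rp by simp
  also have "\<dots> = A / (\<alpha> * N)"
    unfolding NN using N by (simp add: power2_eq_square)
  finally have "A / (\<alpha> * N) = E / 2 * (N powr \<alpha> * r powr \<alpha>)" ..
  \<comment> \<open>Equality holds with \<open>N * r\<close> in place of \<open>2 * N * r\<close>,
    so a factor 2^\<alpha> is given away here.\<close>
  also have "\<dots> \<le> E / 2 * (2 * N * r) powr \<alpha>"
  proof (rule mult_left_mono)
    have "N powr \<alpha> * r powr \<alpha> = (N * r) powr \<alpha>" using N r0 by (simp add: powr_mult)
    also have "\<dots> \<le> (2 * N * r) powr \<alpha>" using N r0 \<alpha> by (intro powr_mono2) auto
    finally show "N powr \<alpha> * r powr \<alpha> \<le> (2 * N * r) powr \<alpha>" .
  qed (use E0 in simp)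
  finally show "A / (\<alpha> * N) \<le> E / 2 * (2 * N * (2 * N\<^sup>2 * E)) powr \<alpha>" unfolding r_def .
qed

text \<open>The balanced choice of \<open>\<delta>\<close> is \<open>r\<close> times the mean slope, where \<open>r = 2 K\<^sup>2 E\<close> and \<open>E\<close> is the
  target; \<open>\<delta>\<close> is lowered to the largest slope \<open>M\<close> when it exceeds it.\<close>

lemma (in measure_modulus) powr_modulus_interpolation:
  assumes ab: "a < b" and f: "convex_concave_on {a..b} f" and cont: "continuous_on {a..b} f"
    and mon: "mono_on {a..b} f \<or> antimono_on {a..b} f"
    and K: "K \<ge> 1" and m0: "0 \<le> m"
    and V: "V = \<bar>f b - f a\<bar>" "0 < V"
    and slope_ge: "\<And>x y. a \<le> x \<Longrightarrow> x < y \<Longrightarrow> y \<le> b \<Longrightarrow> m * (y - x) \<le> \<bar>f y - f x\<bar>"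
    and slope_le: "\<And>x y. a \<le> x \<Longrightarrow> x < y \<Longrightarrow> y \<le> b \<Longrightarrow> ereal (\<bar>f y - f x\<bar> / (y - x)) \<le> M"
    and A: "1 \<le> A" and \<alpha>: "0 < \<alpha>" "\<alpha> \<le> 1"
    and w: "\<And>u. 0 \<le> u \<Longrightarrow> w u = w 0 + A * u powr \<alpha> / (b - a) powr \<alpha>"
  shows "\<exists>g. linear_interpolation (2 * K) f a b g \<and> (LINT x:{a..b}|Q. \<bar>f x - g x\<bar>) \<le>
      V * (w 0 + (2 powr (1 - \<alpha>) * A / (\<alpha> * real K powr (1 + 3 * \<alpha>))) powr (1 / (1 + \<alpha>)))"
proof -
  define N where "N = real K"
  define L where "L = b - a"
  define \<Delta> where "\<Delta> = V / L"
  define E where "E = (2 powr (1 - \<alpha>) * A / (\<alpha> * N powr (1 + 3 * \<alpha>))) powr (1 / (1 + \<alpha>))"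
  define r where "r = 2 * N\<^sup>2 * E"
  have N: "1 \<le> N" using K by (simp add: N_def)
  have L: "0 < L" using ab by (simp add: L_def)
  have \<Delta>: "0 < \<Delta>" "\<Delta> * L = V" using V L by (auto simp: \<Delta>_def)
  have r: "1 \<le> r" and bal: "A / (\<alpha> * N) \<le> E / 2 * (2 * N * r) powr \<alpha>"
    using powr_balance[OF A \<alpha> N] by (simp_all add: E_def r_def)
  have E: "0 \<le> E" "r / (4 * N\<^sup>2) = E / 2" using N by (auto simp: E_def r_def)
  have m\<Delta>: "m \<le> \<Delta>"
    using slope_ge[of a b] ab V L by (simp add: \<Delta>_def L_def pos_le_divide_eq)
  have M\<Delta>: "ereal \<Delta> \<le> M" using slope_le[of a b] ab V by (simp add: \<Delta>_def L_def)
  \<comment> \<open>The flat side gets half of the target: \<open>m\<close> is dropped, and r / (4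
    N^2) = E / 2 by the choice of \<open>r\<close>.\<close>
  have shallow: "(\<delta> - m) * (b - a) / (4 * (real K)\<^sup>2) \<le> V * (E / 2)" if "\<delta> \<le> \<Delta> * r" for \<delta>
  proof -
    have "(\<delta> - m) * L \<le> \<Delta> * r * L" using that m0 L by (intro mult_right_mono) auto
    also have "\<dots> = V * r" using \<Delta>(2) by (simp add: mult_ac flip: \<Delta>(2))
    finally have "(\<delta> - m) * L / (4 * N\<^sup>2) \<le> V * r / (4 * N\<^sup>2)" by (rule divide_right_mono) simp
    also have "\<dots> = V * (E / 2)" by (simp only: E(2) flip: times_divide_eq_right)
    finally show ?thesis by (simp add: L_def N_def)
  qed
  have slope_z: "2 * N * z * \<bar>f y - f x\<bar> \<le> V * (y - x)"
    if "2 * N * z * (\<bar>f y - f x\<bar> / (y - x)) \<le> V" "x < y" for x y z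
    using mult_right_mono[OF that(1), of "y - x"] that(2) by simp
  have "\<exists>g. linear_interpolation (2 * K) f a b g \<and> (LINT x:{a..b}|Q. \<bar>f x - g x\<bar>) \<le> V * (w 0 + E)"
  proof (cases "ereal (\<Delta> * r) \<le> M")
    case True
    \<comment> \<open>The lower argument of \<open>Psi\<close> is taken to be 0. This is allowed for
      every \<open>M\<close> and discards only a term that would improve the bound.\<close>
    have "\<exists>g. linear_interpolation (2 * K) f a b g \<and>
     (LINT x:{a..b}|Q. \<bar>f x - g x\<bar>) \<le> V * w 0 + (\<Delta> * r - m) * (b - a) / (4 * (real K)\<^sup>2)
           + V / real K * (Psi w (V / (2 * real K * (\<Delta> * r))) - Psi w 0)"
    proof (rule convex_concave_interpolation_integral_le[OF ab f cont mon K _ _ _ V(1) slope_ge])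
      have "\<Delta> * 1 \<le> \<Delta> * r" using r \<Delta> by (intro mult_left_mono) auto
      then show "m \<le> \<Delta> * r" using m\<Delta> by simp
      show "0 < \<Delta> * r" using r \<Delta> by simp
    qed (use V r \<Delta> in auto)
    then obtain g where g: "linear_interpolation (2 * K) f a b g"
      "(LINT x:{a..b}|Q. \<bar>f x - g x\<bar>) \<le> V * w 0 + (\<Delta> * r - m) * (b - a) / (4 * (real K)\<^sup>2)
           + V / real K * (Psi w (V / (2 * real K * (\<Delta> * r))) - Psi w 0)" by blast
    have w': "w u = w 0 + A / L powr \<alpha> * u powr \<alpha>" if "0 \<le> u" for u
      using w[OF that] by (simp add: L_def)
    have c: "0 \<le> A / L powr \<alpha>" using A by simp
    have Psi: "Psi w x = A / L powr \<alpha> / \<alpha> * x powr \<alpha>" if "0 \<le> x" for x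
      by (rule Psi_powr(2)[OF c \<alpha>(1) w' that])
    have "V / (2 * N * (\<Delta> * r)) = L / (2 * N * r)" using \<Delta> L V by (simp add: \<Delta>_def)
    then have "Psi w (V / (2 * N * (\<Delta> * r))) = A / L powr \<alpha> / \<alpha> * (L / (2 * N * r)) powr \<alpha>"
      using Psi[of "L / (2 * N * r)"] L N r by simp
    also have "\<dots> = A / \<alpha> / (2 * N * r) powr \<alpha>"
      using L N r by (simp add: powr_divide)
    finally have "V / N * (Psi w (V / (2 * N * (\<Delta> * r))) - Psi w 0) = V * (A / (\<alpha> * N) / (2 * N * r) powr \<alpha>)"
      using Psi[of 0] by (simp add: mult_ac)
    also have "\<dots> \<le> V * (E / 2)"
    proof (rule mult_left_mono)
      have P: "0 < (2 * N * r) powr \<alpha>" using N r by simp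
      show "A / (\<alpha> * N) / (2 * N * r) powr \<alpha> \<le> E / 2" unfolding pos_divide_le_eq[OF P] by (rule bal)
    qed (use V in simp)
    finally have "V / real K * (Psi w (V / (2 * real K * (\<Delta> * r))) - Psi w 0) \<le> V * (E / 2)"
      by (simp add: N_def)
    with g(2) shallow[of "\<Delta> * r"] have "(LINT x:{a..b}|Q. \<bar>f x - g x\<bar>) \<le> V * w 0 + V * (E / 2) + V * (E / 2)"
      by linarith
    also have "\<dots> = V * (w 0 + E)" by (simp add: distrib_left)
    finally show ?thesis using g(1) by blast
  next
    case False
    then obtain M' where M': "M = ereal M'" "M' < \<Delta> * r" using M\<Delta> by (cases M) auto
    have MD: "\<Delta> \<le> M'" "0 < M'" using M\<Delta> \<Delta> M' by auto
    \<comment> \<open>With \<delta> equal to the largest slope the two arguments of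
      \<open>Psi\<close> coincide, so the steep term vanishes and only the flat one is left.\<close>
    define z where "z = V / (2 * N * M')"
    have z0: "0 \<le> z" using V N MD by (simp add: z_def)
    have "\<exists>g. linear_interpolation (2 * K) f a b g \<and>
     (LINT x:{a..b}|Q. \<bar>f x - g x\<bar>) \<le> V * w 0 + (M' - m) * (b - a) / (4 * (real K)\<^sup>2)
           + V / real K * (Psi w (V / (2 * real K * M')) - Psi w z)"
    proof (rule convex_concave_interpolation_integral_le[OF ab f cont mon K MD(2) _ z0 V(1) slope_ge])
      show "m \<le> M'" using m\<Delta> MD by simp
      show "z \<le> V / (2 * real K * M')" by (simp add: z_def N_def)
      fix x y assume xy: "a \<le> x" "x < y" "y \<le> b"
      have "2 * N * z * (\<bar>f y - f x\<bar> / (y - x)) \<le> 2 * N * z * M'"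
        using slope_le[OF xy] M' z0 N by (intro mult_left_mono) auto
      also have "\<dots> = V" using N MD by (simp add: z_def)
      finally show "2 * real K * z * \<bar>f y - f x\<bar> \<le> V * (y - x)"
        using slope_z xy(2) unfolding N_def by blast
    qed
    then obtain g where g: "linear_interpolation (2 * K) f a b g"
      "(LINT x:{a..b}|Q. \<bar>f x - g x\<bar>) \<le> V * w 0 + (M' - m) * (b - a) / (4 * (real K)\<^sup>2)"
      by (auto simp: z_def N_def)
    have "V * (E / 2) \<le> V * E" using V E by simp
    with g(2) shallow[of M'] M' have "(LINT x:{a..b}|Q. \<bar>f x - g x\<bar>) \<le> V * w 0 + V * E"
      by linarith
    also have "\<dots> = V * (w 0 + E)" by (simp add: distrib_left)
    finally show ?thesis using g(1) by blast
  qed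
  then show ?thesis unfolding E_def N_def .
qed

text \<open>A positive mean slope keeps both quotients away from 0 / 0, and an infinite
  \<open>M\<close> contributes 0. The index is then an ordinary real number.\<close>

lemma linear_index_eq:
  assumes "0 < \<Delta>" "\<Delta> = \<bar>(f b - f a) / (b - a)\<bar>"
    and "min_end_slope f a b = ereal m" "max_end_slope f a b = M" "ereal \<Delta> \<le> M"
  shows "linear_index f a b = ereal (1 - (m / \<Delta> + real_of_ereal (ereal \<Delta> / M)) / 2)"
proof -
  have "quotient1 (ereal m) (ereal \<Delta>) = ereal (m / \<Delta>)"
    using assms(1) by (simp add: quotient1_def)
  moreover have "quotient1 (ereal \<Delta>) M = ereal (real_of_ereal (ereal \<Delta> / M))"
    using assms(1,5) by (cases M) (auto simp: quotient1_def)
  ultimately show ?thesis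
    unfolding linear_index_def Let_def assms(2)[symmetric] assms(3,4)
    by (simp add: one_ereal_def)
qed

lemma (in measure_modulus) linear_modulus_interpolation:
  assumes ab: "a < b" and f: "convex_concave_on {a..b} f" and cont: "continuous_on {a..b} f"
    and mon: "mono_on {a..b} f \<or> antimono_on {a..b} f"
    and K: "K \<ge> 1" and m0: "0 \<le> m"
    and V: "V = \<bar>f b - f a\<bar>" "0 < V"
    and slope_ge: "\<And>x y. a \<le> x \<Longrightarrow> x < y \<Longrightarrow> y \<le> b \<Longrightarrow> m * (y - x) \<le> \<bar>f y - f x\<bar>"
    and slope_le: "\<And>x y. a \<le> x \<Longrightarrow> x < y \<Longrightarrow> y \<le> b \<Longrightarrow> ereal (\<bar>f y - f x\<bar> / (y - x)) \<le> M"
    and mM: "min_end_slope f a b = ereal m" "max_end_slope f a b = M"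
    and w: "\<And>u. 0 \<le> u \<Longrightarrow> w u = w 0 + u / (b - a)"
  shows "\<exists>g \<Gamma>. linear_interpolation (2 * K) f a b g \<and> linear_index f a b = ereal \<Gamma> \<and> \<Gamma> \<le> 1 \<and>
      (LINT x:{a..b}|Q. \<bar>f x - g x\<bar>) \<le> V * (w 0 + \<Gamma> / (real K)\<^sup>2)"
proof -
  define N where "N = real K"
  define L where "L = b - a"
  define \<Delta> where "\<Delta> = V / L"
  have N: "1 \<le> N" using K by (simp add: N_def)
  have L: "0 < L" using ab by (simp add: L_def)
  have \<Delta>: "0 < \<Delta>" "\<Delta> * L = V" using V L by (auto simp: \<Delta>_def)
  have m\<Delta>: "m \<le> \<Delta>"
    using slope_ge[of a b] ab V L by (simp add: \<Delta>_def L_def pos_le_divide_eq)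
  have M\<Delta>: "ereal \<Delta> \<le> M" using slope_le[of a b] ab V by (simp add: \<Delta>_def L_def)
  define G where "G = real_of_ereal (ereal \<Delta> / M)"
  define \<Gamma> where "\<Gamma> = 1 - (m / \<Delta> + G) / 2"
  have \<Gamma>: "linear_index f a b = ereal \<Gamma>"
    unfolding \<Gamma>_def G_def using ab \<Delta> mM M\<Delta>
    by (intro linear_index_eq) (auto simp: \<Delta>_def V(1) L_def)
  define z where "z = real_of_ereal (ereal V / (ereal (2 * N) * M))"
  have z: "0 \<le> z" "z \<le> V / (2 * N * \<Delta>)" "\<And>s. ereal s \<le> M \<Longrightarrow> 2 * N * z * s \<le> V"
    using real_of_ereal_slope_quotient[of V N \<Delta> M] V N \<Delta> M\<Delta> unfolding z_def by auto
  \<comment> \<open>Both sides are V / (2 N M), since V = \<Delta> L; both are 0 when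
    \<open>M\<close> is infinite.\<close>
  have zG: "z = L * G / (2 * N)"
    using M\<Delta> \<Delta> N unfolding z_def G_def by (cases M) (auto simp: mult_ac simp flip: \<Delta>(2))
  then have G: "0 \<le> G" using z(1) L N by (simp add: zero_le_divide_iff zero_le_mult_iff)
  have "\<exists>g. linear_interpolation (2 * K) f a b g \<and>
     (LINT x:{a..b}|Q. \<bar>f x - g x\<bar>) \<le> V * w 0 + (\<Delta> - m) * (b - a) / (4 * (real K)\<^sup>2)
           + V / real K * (Psi w (V / (2 * real K * \<Delta>)) - Psi w z)"
  proof (rule convex_concave_interpolation_integral_le[OF ab f cont mon K \<Delta>(1) m\<Delta> z(1) V(1) slope_ge])
    fix x y assume xy: "a \<le> x" "x < y" "y \<le> b"
    have "2 * N * z * (\<bar>f y - f x\<bar> / (y - x)) * (y - x) \<le> V * (y - x)"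
      using z(3)[OF slope_le[OF xy]] xy by (intro mult_right_mono) auto
    then show "2 * real K * z * \<bar>f y - f x\<bar> \<le> V * (y - x)" using xy by (simp add: N_def)
  next
    show "z \<le> V / (2 * real K * \<Delta>)" using z(2) unfolding N_def .
  qed
  then obtain g where g: "linear_interpolation (2 * K) f a b g"
    "(LINT x:{a..b}|Q. \<bar>f x - g x\<bar>) \<le> V * w 0 + (\<Delta> - m) * L / (4 * N\<^sup>2)
           + V / N * (Psi w (V / (2 * N * \<Delta>)) - Psi w z)" unfolding N_def L_def by blast
  have w': "w u = w 0 + 1 / L * u powr 1" if "0 \<le> u" for u
    unfolding w[OF that] L_def using that by simp
  have Psi: "Psi w x = x / L" if "0 \<le> x" for x
  proof -
    have "Psi w x = 1 / L / 1 * x powr 1"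
      by (rule Psi_powr(2)[OF _ _ w' that]) (use L in simp_all)
    then show ?thesis using that by simp
  qed
  have "V / (2 * N * \<Delta>) = L / (2 * N)" unfolding \<Delta>(2)[symmetric] using \<Delta>(1) by simp
  then have "Psi w (V / (2 * N * \<Delta>)) - Psi w z = (1 - G) / (2 * N)"
    using Psi[of z] Psi[of "L / (2 * N)"] z(1) L N zG by (simp add: diff_divide_distrib)
  then have "V / N * (Psi w (V / (2 * N * \<Delta>)) - Psi w z) = V / N * ((1 - G) / (2 * N))" by simp
  also have "\<dots> = V / (4 * N\<^sup>2) * (2 - 2 * G)"
    using N by (simp add: power2_eq_square field_simps)
  finally have e1: "V / N * (Psi w (V / (2 * N * \<Delta>)) - Psi w z) = V / (4 * N\<^sup>2) * (2 - 2 * G)" .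
  have "(\<Delta> - m) * L = V * (1 - m / \<Delta>)"
    unfolding \<Delta>(2)[symmetric] using \<Delta>(1) by (simp add: algebra_simps)
  then have e2: "(\<Delta> - m) * L / (4 * N\<^sup>2) = V / (4 * N\<^sup>2) * (1 - m / \<Delta>)" by simp
  have "V / (4 * N\<^sup>2) * (1 - m / \<Delta>) + V / (4 * N\<^sup>2) * (2 - 2 * G) = V / (4 * N\<^sup>2) * (3 - m / \<Delta> - 2 * G)"
    unfolding distrib_left[symmetric] by simp
  with g(2)[unfolded e1 e2]
  have "(LINT x:{a..b}|Q. \<bar>f x - g x\<bar>) \<le> V * w 0 + V / (4 * N\<^sup>2) * (3 - m / \<Delta> - 2 * G)"
    by linarith
  also have "\<dots> \<le> V * w 0 + V / (4 * N\<^sup>2) * (4 * \<Gamma>)"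
  proof -
    define \<mu> where "\<mu> = m / \<Delta>"
    have "\<mu> \<le> 1" unfolding \<mu>_def using m\<Delta> \<Delta> by simp
    \<comment> \<open>The right side equals 4 - 2 \<mu> - 2 G, so the step is exactly \<mu> \<le> 1:
      the smallest slope does not exceed the mean one.\<close>
    then have "3 - \<mu> - 2 * G \<le> 4 * (1 - (\<mu> + G) / 2)" by (simp add: field_simps)
    then have "3 - m / \<Delta> - 2 * G \<le> 4 * \<Gamma>" unfolding \<Gamma>_def \<mu>_def .
    then show ?thesis using V by (intro add_left_mono mult_left_mono) auto
  qed
  also have "\<dots> = V * (w 0 + \<Gamma> / N\<^sup>2)" by (simp add: distrib_left)
  finally have "(LINT x:{a..b}|Q. \<bar>f x - g x\<bar>) \<le> V * (w 0 + \<Gamma> / (real K)\<^sup>2)" by (simp add: N_def)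
  moreover have "0 \<le> m / \<Delta>" using m0 \<Delta> by simp
  then have "\<Gamma> \<le> 1" using G by (simp add: \<Gamma>_def)
  ultimately show ?thesis using g(1) \<Gamma> by blast
qed

section \<open>Assembly of the claims\<close>

lemma linear_interpolation_integral_le_uniform:
  assumes Q: "prob_space Q" and B: "0 \<le> B"
    and "\<exists>g. linear_interpolation n f a b g \<and> (\<forall>x\<in>{a..b}. \<bar>f x - g x\<bar> \<le> B)"
  shows "\<exists>g. linear_interpolation n f a b g \<and> (LINT x:{a..b}|Q. \<bar>f x - g x\<bar>) \<le> B"
proof -
  obtain g where "linear_interpolation n f a b g" "\<And>x. x \<in> {a..b} \<Longrightarrow> \<bar>f x - g x\<bar> \<le> B"
    using assms(3) by blast
  then show ?thesis
    by (intro mean_interpolable_integral_le[OF _ B] mean_interpolable_uniform[OF Q])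
qed

theorem theorem2:
  fixes a b :: real and Q :: "real measure" and K :: nat and f :: "real \<Rightarrow> real"
  assumes "a < b"
    and "real_distribution Q" and "measure Q {a..b} = 1"
    and "K \<ge> 1"
    and "continuous_on {a..b} f"
    and "mono_on {a..b} f \<or> antimono_on {a..b} f"
    and "convex_concave_on {a..b} f"
  shows
    "let V = \<bar>f b - f a\<bar>;
         d = \<bar>right_derivative f a - left_derivative f b\<bar>;
         \<delta>min = min_end_slope f a b;
         \<delta>max = max_end_slope f a b;
         err = (\<lambda>g. LINT x:{a..b}|Q. \<bar>f x - g x\<bar>)
     in
       (d \<noteq> \<infinity> \<longrightarrow>
          (\<exists>g. linear_interpolation K f a b g \<and>
             ereal (err g) \<le> d * ereal ((b - a) / (4 * (real K)\<^sup>2)))) \<and>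
       (\<forall>w. is_modulus Q w \<and> Psi_finite w \<longrightarrow>
          (\<forall>\<delta>::real. \<delta> > 0 \<and> \<delta>min \<le> ereal \<delta> \<and> ereal \<delta> \<le> \<delta>max \<longrightarrow>
             (\<exists>g. linear_interpolation (2 * K) f a b g \<and>
                ereal (err g) \<le>
                  ereal (V * w 0)
                  + (ereal \<delta> - \<delta>min) * ereal ((b - a) / (4 * (real K)\<^sup>2))
                  + ereal (V / real K *
                      (Psi w (V / (2 * real K * \<delta>))
                       - Psi w (real_of_ereal (ereal V / (ereal (2 * real K) * \<delta>max)))))))) \<and>
       (\<forall>w A \<alpha>. is_modulus Q w \<and> A \<ge> 1 \<and> 0 < \<alpha> \<and> \<alpha> \<le> 1 \<and>
            (\<forall>u\<ge>0. w u = w 0 + A * u powr \<alpha> / (b - a) powr \<alpha>) \<longrightarrow>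
          (\<exists>g. linear_interpolation (2 * K) f a b g \<and>
             err g \<le> V * (w 0 +
               (2 powr (1 - \<alpha>) * A / (\<alpha> * real K powr (1 + 3 * \<alpha>))) powr (1 / (1 + \<alpha>))) \<and>
             (\<alpha> = 1 \<and> A = 1 \<longrightarrow>
                ereal (err g) \<le>
                  ereal V * (ereal (w 0) + linear_index f a b / ereal ((real K)\<^sup>2)))))"
proof -
  interpret Q: real_distribution Q by fact
  have PQ: "prob_space Q" by (rule Q.prob_space_axioms)
  note ab = \<open>a < b\<close> and K = \<open>K \<ge> 1\<close> and cont = \<open>continuous_on {a..b} f\<close>
    and mon = \<open>mono_on {a..b} f \<or> antimono_on {a..b} f\<close> and f = \<open>convex_concave_on {a..b} f\<close>
  define V where "V = \<bar>f b - f a\<bar>"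
  have V0: "0 \<le> V" by (simp add: V_def)
  obtain m M where m0: "0 \<le> m" and mM: "min_end_slope f a b = ereal m" "max_end_slope f a b = M"
    and d: "\<bar>right_derivative f a - left_derivative f b\<bar> = M - ereal m"
    and slopes: "\<And>x y. a \<le> x \<Longrightarrow> x < y \<Longrightarrow> y \<le> b \<Longrightarrow>
         ereal m \<le> ereal (\<bar>f y - f x\<bar> / (y - x)) \<and> ereal (\<bar>f y - f x\<bar> / (y - x)) \<le> M"
    using end_slopes[OF ab f mon] by blast
  have slope_ge: "m * (y - x) \<le> \<bar>f y - f x\<bar>" if "a \<le> x" "x < y" "y \<le> b" for x y
    using slopes[OF that] that by (simp add: pos_le_divide_eq)
  have slope_le: "ereal (\<bar>f y - f x\<bar> / (y - x)) \<le> M" if "a \<le> x" "x < y" "y \<le> b" for x y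
    using slopes[OF that] by blast
  let ?err = "\<lambda>g. LINT x:{a..b}|Q. \<bar>f x - g x\<bar>"
  have N: "1 \<le> real K" using K by simp
  have i: "\<exists>g. linear_interpolation K f a b g \<and>
             ereal (?err g) \<le> (M - ereal m) * ereal ((b - a) / (4 * (real K)\<^sup>2))"
    if "M - ereal m \<noteq> \<infinity>"
  proof -
    have "ereal m \<le> M" using slopes[of a b] ab order_trans by blast
    with that obtain M' where M': "M = ereal M'" "m \<le> M'" by (cases M) auto
    have M'_le: "\<bar>f y - f x\<bar> \<le> M' * (y - x)" if "a \<le> x" "x < y" "y \<le> b" for x y
      using slope_le[OF that] that by (simp add: M' pos_divide_le_eq)
    have B: "0 \<le> (M' - m) * (b - a) / (4 * (real K)\<^sup>2)" using M' ab by simp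
    obtain g where "linear_interpolation K f a b g"
      "?err g \<le> (M' - m) * (b - a) / (4 * (real K)\<^sup>2)"
      using linear_interpolation_integral_le_uniform[OF PQ B
          convex_concave_interpolation_uniform[OF K ab f cont mon slope_ge M'_le]] by blast
    then show ?thesis unfolding M' by (intro exI[of _ g]) simp
  qed
  have ii: "\<exists>g. linear_interpolation (2 * K) f a b g \<and>
                ereal (?err g) \<le>
                  ereal (V * w 0)
                  + (ereal \<delta> - ereal m) * ereal ((b - a) / (4 * (real K)\<^sup>2))
                  + ereal (V / real K *
                      (Psi w (V / (2 * real K * \<delta>))
                       - Psi w (real_of_ereal (ereal V / (ereal (2 * real K) * M)))))"
    if w: "is_modulus Q w" "Psi_finite w" and \<delta>: "\<delta> > 0" "ereal m \<le> ereal \<delta>" "ereal \<delta> \<le> M" for w \<delta>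
  proof -
    interpret measure_modulus Q w by (rule measure_modulusI) fact+
    define z where "z = real_of_ereal (ereal V / (ereal (2 * real K) * M))"
    have N0: "0 < real K" using N by simp
    note z = real_of_ereal_slope_quotient[OF V0 N0 \<delta>(1,3), folded z_def]
    have slope_z: "2 * real K * z * \<bar>f y - f x\<bar> \<le> V * (y - x)" if "a \<le> x" "x < y" "y \<le> b" for x y
    proof -
      have "2 * real K * z * (\<bar>f y - f x\<bar> / (y - x)) * (y - x) \<le> V * (y - x)"
        using z(3)[OF slope_le[OF that]] that by (intro mult_right_mono) auto
      then show ?thesis using that by simp
    qed
    have m\<delta>: "m \<le> \<delta>" using \<delta> by simp
    obtain g where "linear_interpolation (2 * K) f a b g"
      "?err g \<le> V * w 0 + (\<delta> - m) * (b - a) / (4 * (real K)\<^sup>2)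
           + V / real K * (Psi w (V / (2 * real K * \<delta>)) - Psi w z)"
      using convex_concave_interpolation_integral_le[OF ab f cont mon K \<delta>(1) m\<delta> z(1) V_def
          slope_ge slope_z z(2)] by blast
    then show ?thesis unfolding z_def[symmetric] by (intro exI[of _ g]) simp
  qed
  have iii: "\<exists>g. linear_interpolation (2 * K) f a b g \<and>
             ?err g \<le> V * (w 0 +
               (2 powr (1 - \<alpha>) * A / (\<alpha> * real K powr (1 + 3 * \<alpha>))) powr (1 / (1 + \<alpha>))) \<and>
             (\<alpha> = 1 \<and> A = 1 \<longrightarrow>
                ereal (?err g) \<le>
                  ereal V * (ereal (w 0) + linear_index f a b / ereal ((real K)\<^sup>2)))"
    if w: "is_modulus Q w" and A: "A \<ge> 1" and \<alpha>: "0 < \<alpha>" "\<alpha> \<le> 1"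
      and form: "\<forall>u\<ge>0. w u = w 0 + A * u powr \<alpha> / (b - a) powr \<alpha>" for w A \<alpha>
  proof (cases "V = 0")
    case True
    \<comment> \<open>If \<open>V = 0\<close> then \<open>f\<close> is constant by monotonicity, and
      the uniform bound with both slopes 0 gives error 0. This case is separate because the mean
      slope serves as a positive divisor below.\<close>
    have zero: "\<bar>f y - f x\<bar> \<le> 0 * (y - x)" if "a \<le> x" "x < y" "y \<le> b" for x y
      using mon True that monotone_onD[of "{a..b}" "(\<le>)" "(\<le>)" f] monotone_onD[of "{a..b}" "(\<le>)" "(\<ge>)" f]
      by (auto simp: V_def) (smt (verit) atLeastAtMost_iff)+
    have ge: "0 * (y - x) \<le> \<bar>f y - f x\<bar>" for x y by simp
    have K2: "2 * K \<ge> 1" using K by simp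
    obtain g where "linear_interpolation (2 * K) f a b g" "?err g \<le> 0"
      using linear_interpolation_integral_le_uniform[OF PQ _
          convex_concave_interpolation_uniform[OF K2 ab f cont mon ge zero]] by auto
    \<comment> \<open>In the extended reals 0 times anything is 0, so the value of the linear index
      does not have to be computed.\<close>
    then show ?thesis unfolding True by (intro exI[of _ g]) (simp flip: zero_ereal_def)
  next
    case False
    then have V: "0 < V" using V0 by simp
    have w': "w u = w 0 + A / (b - a) powr \<alpha> * u powr \<alpha>" if "0 \<le> u" for u
      unfolding form[rule_format, OF that] by simp
    have "Psi_finite w" by (rule Psi_powr(1)[OF _ \<alpha>(1) w']) (use A in simp)
    then interpret measure_modulus Q w using assms(2) w by (intro measure_modulusI)
    show ?thesis
    proof (cases "\<alpha> = 1 \<and> A = 1")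
      case False
      have "\<exists>g. linear_interpolation (2 * K) f a b g \<and> ?err g \<le> V * (w 0 +
          (2 powr (1 - \<alpha>) * A / (\<alpha> * real K powr (1 + 3 * \<alpha>))) powr (1 / (1 + \<alpha>)))"
        by (rule powr_modulus_interpolation[OF ab f cont mon K m0 V_def V slope_ge slope_le A \<alpha>
              form[rule_format]])
      with False show ?thesis by blast
    next
      case True
      have "w u = w 0 + u / (b - a)" if "0 \<le> u" for u
        unfolding form[rule_format, OF that] using that True ab by simp
      then obtain g \<Gamma> where g: "linear_interpolation (2 * K) f a b g"
        and \<Gamma>: "linear_index f a b = ereal \<Gamma>" "\<Gamma> \<le> 1"
        and le: "?err g \<le> V * (w 0 + \<Gamma> / (real K)\<^sup>2)"
        using linear_modulus_interpolation[OF ab f cont mon K m0 V_def V slope_ge slope_le mM] by blast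
      \<comment> \<open>For \<alpha> = A = 1 the general bound has the relative error 1 / K^2, so it
        follows from the sharper one with \<Gamma> \<le> 1, and one interpolation serves for
        both.\<close>
      have "1 / real K powr 4 = (1 / (real K)\<^sup>2)\<^sup>2" using N by (simp add: power_divide)
      then have "(1 / real K powr 4) powr (1 / 2) = 1 / (real K)\<^sup>2"
        by (simp only: powr_half_sqrt zero_le_power2 real_sqrt_abs) simp
      then have E: "(2 powr (1 - \<alpha>) * A / (\<alpha> * real K powr (1 + 3 * \<alpha>))) powr (1 / (1 + \<alpha>)) = 1 / (real K)\<^sup>2"
        using True by simp
      have "\<Gamma> / (real K)\<^sup>2 \<le> 1 / (real K)\<^sup>2" using \<Gamma>(2) by (rule divide_right_mono) simp
      then have "V * (w 0 + \<Gamma> / (real K)\<^sup>2) \<le> V * (w 0 + 1 / (real K)\<^sup>2)"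
        using V by (intro mult_left_mono) auto
      with le have "?err g \<le> V * (w 0 + 1 / (real K)\<^sup>2)" by linarith
      moreover have "ereal (?err g) \<le> ereal V * (ereal (w 0) + ereal \<Gamma> / ereal ((real K)\<^sup>2))"
        using le K by simp
      ultimately show ?thesis unfolding E \<Gamma>(1) using g by blast
    qed
  qed
  show ?thesis
    unfolding Let_def V_def[symmetric] d mM
    using i ii iii by blast
qed

end
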